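(* In a linear resistive circuit all of whose elements are trainable conductances, the vector fields of equilibrium propagation (EP), coupled learning (CL) and adjoint coupled learning (AL) are homogeneous in $\kappa$ of degrees $-1$, $0$ and $+1$: for all $c>0$ and all $\kappa$ in their domain $\mathcal D$, $$F_{\mathrm{EP}}(c\kappa)=c^{-1}F_{\mathrm{EP}}(\kappa),\qquad F_{\mathrm{CL}}(c\kappa)=F_{\mathrm{CL}}(\kappa),\qquad F_{\mathrm{AL}}(c\kappa)=c\,F_{\mathrm{AL}}(\kappa).$$ For each of the three rules and each $c>0$, the map $\kappa\mapsto c\kappa$ sends learning orbits to learning orbits (the orbit from $\kappa_0$ is mapped onto the orbit from $c\kappa_0$, up to a reparametrization of time), so the $\omega$-limit from $c\kappa_0$ is $c$ times the $\omega$-limit from $\kappa_0$: $\omega(c\kappa_0)=c\,\omega(\kappa_0)$. Moreover $A_C(c\kappa)=A_C(\kappa)$ for all $\kappa\in\mathcal D$ and $c>0$, so the selected input-output map is the same from both initializations, i.e. $$\{A_C(\kappa):\kappa\in\omega(c\kappa_0)\cap\mathcal D\}=\{A_C(\kappa):\kappa\in\omega(\kappa_0)\cap\mathcal D\}.$$ Thus the initialization $\kappa_0$ affects the selected input-output map only through its direction $\kappa_0/\|\kappa_0\|$, and the conserved mass $K=\tfrac12\sum_e\kappa_e^2$ of the initialization has no effect on it.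
   Context: Circuit. A connected graph on $N$ nodes with edge set $E$; each edge $e$ has incidence vector $d_e\in\mathbb R^N$ (entries $+1,-1$ at its endpoints, $0$ elsewhere) and a trainable conductance $\kappa_e$. Put $L(\kappa)=\sum_{e\in E}\kappa_e d_ed_e^\top$ and $G(x;\kappa)=\tfrac12\langle x,L(\kappa)x\rangle$ for node voltages $x\in\mathbb R^N$. The matrix $P\in\mathbb R^{N\times I}$ has as columns the distinct standard basis vectors corresponding to a nonempty set of input nodes (ground included), and $Q\in\mathbb R^{N\times O}$ has as columns the distinct standard basis vectors corresponding to the output nodes; input and output nodes are disjoint. An input $v\in\mathbb R^I$ and a target $w\in\mathbb R^O$ are fixed. Let $$\mathcal D=\{\kappa\in[0,\infty)^E:\ L(\kappa)\text{ is positive definite on }\ker P^\top\},$$ which contains $(0,\infty)^E$; a zero conductance represents a removed edge. States. For $\kappa\in\mathcal D$: the free state is $x_0=\arg\min\{G(x;\kappa):P^\top x=v\}$ and the error is $r=Q^\top x_0-w$. The reference state is $x_0^*=\arg\min\{G(x;\kappa):P^\top x=v,\ Q^\top x=w\}$, and the adjoint error $\mu_0\in\mathbb R^O$ is the multiplier of the output constraint in $\nabla_xG(x_0^*;\kappa)=L(\kappa)x_0^*=-P\lambda_0-Q\mu_0$. Resolvent. $R=R(\kappa)$ is the input-constrained resolvent: for $f\in\mathbb R^N$, $Rf$ is the unique $y$ for which there is $\mu\in\mathbb R^I$ with $L(\kappa)y+P\mu=f$, $P^\top y=0$. Put $D=(Q^\top RQ)^{-1}$. Learning fields (zero-nudge,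 continuous-time). $F_e(\kappa)=(d_e^\top y)(d_e^\top x_{\mathrm{ref}})$, with - EP: $x_{\mathrm{ref}}=x_0$, $y=RQr$; - CL: $x_{\mathrm{ref}}=x_0$, $y=RQDr$; - AL: $x_{\mathrm{ref}}=x_0^*$, $y=RQD\mu_0$. Orbits. A learning trajectory of a rule from $\kappa_0\in(0,\infty)^E$ is the maximal continuous, piecewise $C^1$ curve $\kappa:[0,T)\to\mathcal D$, $T\le\infty$, with $\kappa(0)=\kappa_0$, along which $\dot\kappa_e=F_e(\kappa)$ for every edge $e$ not yet removed, where an edge whose conductance reaches $0$ is removed and stays removed ($\kappa_e\equiv0$ from then on). The learning orbit is its image, and its $\omega$-limit $\omega(\kappa_0)$ is the set of accumulation points of $\kappa(t)$ as $t\uparrow T$. Input-output map. For $\kappa\in\mathcal D$, $A_C(\kappa)\in\mathbb R^{O\times I}$ is the matrix such that, for every input $v\in\mathbb R^I$, the free state with input $v$ satisfies $Q^\top x_0=A_C(\kappa)v$. *)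

theory Defs
  imports "HOL-Analysis.Analysis"
begin

section \<open>Circuits\<close>

text \<open>The edge set is the type \<open>'e\<close>; \<open>src\<close> and \<open>dst\<close> give the endpoints of an edge, the orientation
  only fixing the sign of its incidence vector. Parallel edges are not excluded. The column indices of
  the two selection matrices are the types \<open>'i\<close> (inputs) and \<open>'o\<close> (outputs).\<close>

record ('n, 'e, 'i, 'o) circuit =
  src :: "'e \<Rightarrow> 'n"
  dst :: "'e \<Rightarrow> 'n"
  inp :: "'i \<Rightarrow> 'n"
  outp :: "'o \<Rightarrow> 'n"

definition wf_circuit :: "('n, 'e, 'i, 'o) circuit \<Rightarrow> bool" where
  "wf_circuit C \<longleftrightarrow>
     (\<forall>e. src C e \<noteq> dst C e) \<and>
     (\<forall>a b. (a, b) \<in> ({(src C e, dst C e) | e. True} \<union> {(dst C e, src C e) | e. True})\<^sup>*) \<and>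
     inj (inp C) \<and> inj (outp C) \<and> range (inp C) \<inter> range (outp C) = {}"

definition incidence :: "('n::finite, 'e, 'i, 'o) circuit \<Rightarrow> 'e \<Rightarrow> real^'n" where
  "incidence C e = axis (src C e) 1 - axis (dst C e) 1"

definition laplacian :: "('n::finite, 'e::finite, 'i, 'o) circuit \<Rightarrow> real^'e \<Rightarrow> real^'n^'n" where
  "laplacian C \<kappa> = (\<Sum>e\<in>UNIV. \<kappa> $ e *\<^sub>R (\<chi> a b. incidence C e $ a * incidence C e $ b))"

definition energy :: "('n::finite, 'e::finite, 'i, 'o) circuit \<Rightarrow> real^'e \<Rightarrow> real^'n \<Rightarrow> real" where
  "energy C \<kappa> x = 1/2 * (x \<bullet> (laplacian C \<kappa> *v x))"

definition Pmat :: "('n::finite, 'e, 'i::finite, 'o) circuit \<Rightarrow> real^'i^'n" where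
  "Pmat C = (\<chi> a i. axis (inp C i) 1 $ a)"

definition Qmat :: "('n::finite, 'e, 'i, 'o::finite) circuit \<Rightarrow> real^'o^'n" where
  "Qmat C = (\<chi> a j. axis (outp C j) 1 $ a)"

definition conductances :: "('n::finite, 'e::finite, 'i::finite, 'o) circuit \<Rightarrow> (real^'e) set" where
  "conductances C =
     {\<kappa>. (\<forall>e. 0 \<le> \<kappa> $ e) \<and>
         (\<forall>x. transpose (Pmat C) *v x = 0 \<and> x \<noteq> 0 \<longrightarrow> 0 < x \<bullet> (laplacian C \<kappa> *v x))}"

section \<open>States, resolvent and input-output map\<close>

definition free_state ::
  "('n::finite, 'e::finite, 'i::finite, 'o) circuit \<Rightarrow> real^'i \<Rightarrow> real^'e \<Rightarrow> real^'n" where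
  "free_state C v \<kappa> = arg_min (energy C \<kappa>) (\<lambda>x. transpose (Pmat C) *v x = v)"

definition free_error ::
  "('n::finite, 'e::finite, 'i::finite, 'o::finite) circuit
     \<Rightarrow> real^'i \<Rightarrow> real^'o \<Rightarrow> real^'e \<Rightarrow> real^'o" where
  "free_error C v w \<kappa> = transpose (Qmat C) *v free_state C v \<kappa> - w"

definition reference_state ::
  "('n::finite, 'e::finite, 'i::finite, 'o::finite) circuit
     \<Rightarrow> real^'i \<Rightarrow> real^'o \<Rightarrow> real^'e \<Rightarrow> real^'n" where
  "reference_state C v w \<kappa> =
     arg_min (energy C \<kappa>) (\<lambda>x. transpose (Pmat C) *v x = v \<and> transpose (Qmat C) *v x = w)"

definition adjoint_error ::
  "('n::finite, 'e::finite, 'i::finite, 'o::finite) circuit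
     \<Rightarrow> real^'i \<Rightarrow> real^'o \<Rightarrow> real^'e \<Rightarrow> real^'o" where
  "adjoint_error C v w \<kappa> =
     (THE \<mu>. \<exists>l. laplacian C \<kappa> *v reference_state C v w \<kappa> = - (Pmat C *v l) - Qmat C *v \<mu>)"

definition resolvent ::
  "('n::finite, 'e::finite, 'i::finite, 'o) circuit \<Rightarrow> real^'e \<Rightarrow> real^'n \<Rightarrow> real^'n" where
  "resolvent C \<kappa> f =
     (THE y. \<exists>\<mu>. laplacian C \<kappa> *v y + Pmat C *v \<mu> = f \<and> transpose (Pmat C) *v y = 0)"

definition Dmat ::
  "('n::finite, 'e::finite, 'i::finite, 'o::finite) circuit \<Rightarrow> real^'e \<Rightarrow> real^'o^'o" where
  "Dmat C \<kappa> =
     matrix_inv (matrix (\<lambda>z. transpose (Qmat C) *v resolvent C \<kappa> (Qmat C *v z)))"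

definition io_map ::
  "('n::finite, 'e::finite, 'i::finite, 'o::finite) circuit \<Rightarrow> real^'e \<Rightarrow> real^'i^'o" where
  "io_map C \<kappa> = (THE A. \<forall>v. transpose (Qmat C) *v free_state C v \<kappa> = A *v v)"

section \<open>Learning fields\<close>

datatype rule = EP | CL | AL

fun field_state ::
  "('n::finite, 'e::finite, 'i::finite, 'o::finite) circuit
     \<Rightarrow> real^'i \<Rightarrow> real^'o \<Rightarrow> rule \<Rightarrow> real^'e \<Rightarrow> real^'n" where
  "field_state C v w EP \<kappa> = free_state C v \<kappa>"
| "field_state C v w CL \<kappa> = free_state C v \<kappa>"
| "field_state C v w AL \<kappa> = reference_state C v w \<kappa>"

fun field_response ::
  "('n::finite, 'e::finite, 'i::finite, 'o::finite) circuit
     \<Rightarrow> real^'i \<Rightarrow> real^'o \<Rightarrow> rule \<Rightarrow> real^'e \<Rightarrow> real^'n" where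
  "field_response C v w EP \<kappa> = resolvent C \<kappa> (Qmat C *v free_error C v w \<kappa>)"
| "field_response C v w CL \<kappa> = resolvent C \<kappa> (Qmat C *v (Dmat C \<kappa> *v free_error C v w \<kappa>))"
| "field_response C v w AL \<kappa> = resolvent C \<kappa> (Qmat C *v (Dmat C \<kappa> *v adjoint_error C v w \<kappa>))"

definition learning_field ::
  "('n::finite, 'e::finite, 'i::finite, 'o::finite) circuit
     \<Rightarrow> real^'i \<Rightarrow> real^'o \<Rightarrow> rule \<Rightarrow> real^'e \<Rightarrow> real^'e" where
  "learning_field C v w \<rho> \<kappa> =
     (\<chi> e. (incidence C e \<bullet> field_response C v w \<rho> \<kappa>) * (incidence C e \<bullet> field_state C v w \<rho> \<kappa>))"

section \<open>Trajectories, orbits and limit sets\<close>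

text \<open>A curve on \<open>[0,T)\<close> is a total function together with its lifetime \<open>T\<close>, possibly infinite; its
  values off \<open>time_interval T\<close> are irrelevant.\<close>

definition time_interval :: "ereal \<Rightarrow> real set" where
  "time_interval T = {t. 0 \<le> t \<and> ereal t < T}"

definition removed :: "(real \<Rightarrow> real^'e) \<Rightarrow> 'e \<Rightarrow> real \<Rightarrow> bool" where
  "removed k e t \<longleftrightarrow> (\<exists>s. 0 \<le> s \<and> s \<le> t \<and> k s $ e = 0)"

definition learning_curve ::
  "('n::finite, 'e::finite, 'i::finite, 'o::finite) circuit \<Rightarrow> real^'i \<Rightarrow> real^'o \<Rightarrow> rule
     \<Rightarrow> real^'e \<Rightarrow> (real \<Rightarrow> real^'e) \<Rightarrow> ereal \<Rightarrow> bool" where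
  "learning_curve C v w \<rho> \<kappa>0 k T \<longleftrightarrow>
     0 < T \<and> k 0 = \<kappa>0 \<and>
     k piecewise_C1_differentiable_on time_interval T \<and>
     (\<forall>t \<in> time_interval T. k t \<in> conductances C \<and>
        (\<forall>e. if removed k e t then k t $ e = 0
             else ((\<lambda>s. k s $ e) has_real_derivative learning_field C v w \<rho> (k t) $ e)
                    (at t within time_interval T)))"

definition learning_trajectory ::
  "('n::finite, 'e::finite, 'i::finite, 'o::finite) circuit \<Rightarrow> real^'i \<Rightarrow> real^'o \<Rightarrow> rule
     \<Rightarrow> real^'e \<Rightarrow> (real \<Rightarrow> real^'e) \<Rightarrow> ereal \<Rightarrow> bool" where
  "learning_trajectory C v w \<rho> \<kappa>0 k T \<longleftrightarrow>
     learning_curve C v w \<rho> \<kappa>0 k T \<and>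
     (\<forall>k' T'. learning_curve C v w \<rho> \<kappa>0 k' T' \<and> T \<le> T' \<and> (\<forall>t \<in> time_interval T. k' t = k t)
        \<longrightarrow> T' = T)"

definition learning_orbit :: "(real \<Rightarrow> real^'e) \<Rightarrow> ereal \<Rightarrow> (real^'e) set" where
  "learning_orbit k T = k ` time_interval T"

definition omega_limit :: "(real \<Rightarrow> real^'e::finite) \<Rightarrow> ereal \<Rightarrow> (real^'e) set" where
  "omega_limit k T =
     {z. \<exists>s :: nat \<Rightarrow> real. range s \<subseteq> time_interval T \<and>
           (\<lambda>n. ereal (s n)) \<longlonglongrightarrow> T \<and> (\<lambda>n. k (s n)) \<longlonglongrightarrow> z}"

definition selected_maps ::
  "('n::finite, 'e::finite, 'i::finite, 'o::finite) circuit
     \<Rightarrow> (real \<Rightarrow> real^'e) \<Rightarrow> ereal \<Rightarrow> (real^'i^'o) set" where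
  "selected_maps C k T = {io_map C \<kappa> | \<kappa>. \<kappa> \<in> omega_limit k T \<inter> conductances C}"

definition time_change :: "ereal \<Rightarrow> ereal \<Rightarrow> (real \<Rightarrow> real) \<Rightarrow> bool" where
  "time_change T' T \<phi> \<longleftrightarrow>
     bij_betw \<phi> (time_interval T') (time_interval T) \<and> strict_mono_on (time_interval T') \<phi>"

definition mass :: "real^'e::finite \<Rightarrow> real" where
  "mass \<kappa> = 1/2 * (\<Sum>e\<in>UNIV. (\<kappa> $ e)\<^sup>2)"

end

theory Submission
  imports Defs
begin

text \<open>On the domain every state and response is the solution of a Dirichlet problem for the weighted
  Laplacian, with boundary the inputs or the inputs together with the outputs; the response of CL and AL
  simplifies because \<open>R Q D z\<close> is the extension with output voltages \<open>z\<close>. Scaling the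
  conductances leaves an extension of boundary data unchanged and divides the response to sources by the
  same factor, which gives the degrees of homogeneity. A scaled trajectory run at a suitable constant
  speed is therefore again a learning curve, and it is maximal because the scaling can be undone. That it
  is the only one follows from Gronwall's inequality: the fields are locally Lipschitz on the domain,
  including at its boundary faces, and after any given time the set of removed edges stays constant for
  a while.\<close>

section \<open>Selection matrices and the Laplacian\<close>

text \<open>As a simp rule it would turn \<open>transpose A *v x\<close> into \<open>x v* A\<close>;
  without it, the evaluation rules for the transposed selection matrices keep matching.\<close>

declare transpose_matrix_vector [simp del]

lemma transpose_Pmat_mult: "(transpose (Pmat C) *v x) $ i = x $ inp C i"
  by (simp add: matrix_vector_mult_def transpose_def Pmat_def axis_def if_distrib if_distribR
      sum.If_cases Int_def cong: if_cong)

lemma transpose_Qmat_mult: "(transpose (Qmat C) *v x) $ j = x $ outp C j"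
  by (simp add: matrix_vector_mult_def transpose_def Qmat_def axis_def if_distrib if_distribR
      sum.If_cases Int_def cong: if_cong)

lemma Pmat_mult:
  assumes "inj (inp C)"
  shows "(Pmat C *v \<mu>) $ a = (if a \<in> range (inp C) then \<mu> $ inv (inp C) a else 0)"
proof (cases "a \<in> range (inp C)")
  case True
  then obtain i where [simp]: "a = inp C i" by auto
  show ?thesis
    using assms by (simp add: matrix_vector_mult_def Pmat_def axis_def inj_eq if_distrib if_distribR
        cong: if_cong)
next
  case False
  then show ?thesis
    by (auto simp: matrix_vector_mult_def Pmat_def axis_def intro!: sum.neutral)
qed

lemma Qmat_mult:
  assumes "inj (outp C)"
  shows "(Qmat C *v \<mu>) $ a = (if a \<in> range (outp C) then \<mu> $ inv (outp C) a else 0)"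
proof (cases "a \<in> range (outp C)")
  case True
  then obtain i where [simp]: "a = outp C i" by auto
  show ?thesis
    using assms by (simp add: matrix_vector_mult_def Qmat_def axis_def inj_eq if_distrib if_distribR
        cong: if_cong)
next
  case False
  then show ?thesis
    by (auto simp: matrix_vector_mult_def Qmat_def axis_def intro!: sum.neutral)
qed

text \<open>Each summand is a rank-one matrix and sends \<open>x\<close> to a multiple of its
  incidence vector. In this edgewise form the symmetry of the Laplacian is immediate.\<close>

lemma laplacian_mult:
  "laplacian C \<kappa> *v x = (\<Sum>e\<in>UNIV. (\<kappa> $ e * (incidence C e \<bullet> x)) *\<^sub>R incidence C e)"
proof (subst vec_eq_iff, safe)
  fix a
  have "(laplacian C \<kappa> *v x) $ a =
      (\<Sum>b\<in>UNIV. \<Sum>e\<in>UNIV. \<kappa> $ e * (incidence C e $ a * incidence C e $ b) * x $ b)"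
    by (simp add: matrix_vector_mult_def laplacian_def sum_distrib_right)
  also have "\<dots> = (\<Sum>e\<in>UNIV. \<Sum>b\<in>UNIV. \<kappa> $ e * (incidence C e $ a * incidence C e $ b) * x $ b)"
    by (rule sum.swap)
  finally show "(laplacian C \<kappa> *v x) $ a =
      (\<Sum>e\<in>UNIV. (\<kappa> $ e * (incidence C e \<bullet> x)) *\<^sub>R incidence C e) $ a"
    by (simp add: inner_vec_def sum_distrib_left sum_distrib_right mult_ac)
qed

lemma laplacian_symmetric: "x \<bullet> (laplacian C \<kappa> *v y) = y \<bullet> (laplacian C \<kappa> *v x)"
  by (simp add: laplacian_mult inner_sum_right inner_commute mult_ac)

section \<open>Scaling of conductances, energy and states\<close>

lemma laplacian_scale: "laplacian C (c *\<^sub>R \<kappa>) = c *\<^sub>R laplacian C \<kappa>"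
  by (simp add: laplacian_def scaleR_sum_right)

lemma linear_laplacian: "linear (laplacian C)"
  by (rule linearI)
    (simp_all add: laplacian_def scaleR_left_distrib sum.distrib scaleR_sum_right)

lemma laplacian_scale_mult: "laplacian C (c *\<^sub>R \<kappa>) *v x = c *\<^sub>R (laplacian C \<kappa> *v x)"
  by (simp add: laplacian_scale scaleR_matrix_vector_assoc)

lemma energy_scale: "energy C (c *\<^sub>R \<kappa>) x = c * energy C \<kappa> x"
  by (simp add: energy_def laplacian_scale_mult)

lemma conductances_scale:
  assumes "c > 0" "\<kappa> \<in> conductances C"
  shows "c *\<^sub>R \<kappa> \<in> conductances C"
  using assms by (simp add: conductances_def laplacian_scale_mult)

text \<open>A positive factor preserves every strict comparison, so both choice operators act on the
  same predicate and pick the same point.\<close>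

lemma arg_min_scale:
  fixes f g :: "'a \<Rightarrow> real"
  assumes "c > 0" "\<And>x. g x = c * f x"
  shows "arg_min g P = arg_min f P"
  using assms by (simp add: arg_min_def is_arg_min_def)

lemma free_state_scale: "c > 0 \<Longrightarrow> free_state C v (c *\<^sub>R \<kappa>) = free_state C v \<kappa>"
  unfolding free_state_def by (rule arg_min_scale[OF _ energy_scale])

lemma reference_state_scale:
  "c > 0 \<Longrightarrow> reference_state C v w (c *\<^sub>R \<kappa>) = reference_state C v w \<kappa>"
  unfolding reference_state_def by (rule arg_min_scale[OF _ energy_scale])

lemma io_map_scale: "c > 0 \<Longrightarrow> io_map C (c *\<^sub>R \<kappa>) = io_map C \<kappa>"
  by (simp add: io_map_def free_state_scale)

section \<open>The Dirichlet problem\<close>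

text \<open>Identity rows on \<open>B\<close> impose the boundary values, Laplacian rows elsewhere
  the current balance. One square matrix of fixed size thus serves every boundary set, and the
  multipliers are eliminated.\<close>

definition dirichlet_matrix ::
  "('n::finite, 'e::finite, 'i, 'o) circuit \<Rightarrow> 'n set \<Rightarrow> real^'e \<Rightarrow> real^'n^'n" where
  "dirichlet_matrix C B \<kappa> = (\<chi> a. if a \<in> B then axis a 1 else laplacian C \<kappa> $ a)"

text \<open>The single vector \<open>g\<close> carries the boundary voltages on \<open>B\<close> and
  the injected currents off \<open>B\<close>.\<close>

definition dirichlet ::
  "('n::finite, 'e::finite, 'i, 'o) circuit \<Rightarrow> 'n set \<Rightarrow> real^'e \<Rightarrow> real^'n \<Rightarrow> real^'n" where
  "dirichlet C B \<kappa> g = matrix_inv (dirichlet_matrix C B \<kappa>) *v g"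

lemma dirichlet_matrix_mult:
  "(dirichlet_matrix C B \<kappa> *v x) $ a = (if a \<in> B then x $ a else (laplacian C \<kappa> *v x) $ a)"
  by (simp add: matrix_vector_mul_component dirichlet_matrix_def inner_axis')

text \<open>A kernel vector vanishes on \<open>B\<close> and draws no current off \<open>B\<close>,
  so its energy is zero. Since \<open>B\<close> contains the inputs, it lies in the space on which
  the Laplacian is positive definite.\<close>

lemma dirichlet_matrix_invertible:
  assumes "\<kappa> \<in> conductances C" "range (inp C) \<subseteq> B"
  shows "invertible (dirichlet_matrix C B \<kappa>)"
proof -
  have "x = 0" if x: "dirichlet_matrix C B \<kappa> *v x = 0" for x
  proof -
    have B: "x $ a = 0" if "a \<in> B" for a
      using that x by (metis dirichlet_matrix_mult zero_index)
    have N: "(laplacian C \<kappa> *v x) $ a = 0" if "a \<notin> B" for a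
      using that x by (metis dirichlet_matrix_mult zero_index)
    have "x $ a * (laplacian C \<kappa> *v x) $ a = 0" for a using B N by (cases "a \<in> B") auto
    then have "x \<bullet> (laplacian C \<kappa> *v x) = 0" unfolding inner_vec_def inner_real_def by (intro sum.neutral) blast
    moreover have "transpose (Pmat C) *v x = 0"
      unfolding vec_eq_iff transpose_Pmat_mult zero_index using B assms(2) by blast
    ultimately show ?thesis using assms(1) less_irrefl unfolding conductances_def by fastforce
  qed
  then show ?thesis by (simp add: invertible_left_inverse matrix_left_invertible_ker)
qed

lemma dirichlet_eq_iff:
  assumes "\<kappa> \<in> conductances C" "range (inp C) \<subseteq> B"
  shows "dirichlet C B \<kappa> g = x \<longleftrightarrow>
    (\<forall>a\<in>B. x $ a = g $ a) \<and> (\<forall>a. a \<notin> B \<longrightarrow> (laplacian C \<kappa> *v x) $ a = g $ a)"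
proof -
  let ?M = "dirichlet_matrix C B \<kappa>"
  have "invertible ?M" by (rule dirichlet_matrix_invertible[OF assms])
  \<comment> \<open>\<open>matrix_inv\<close> is a choice operator; invertibility makes it a
    two-sided inverse.\<close>
  then have "?M ** matrix_inv ?M = mat 1" "matrix_inv ?M ** ?M = mat 1"
    unfolding invertible_def matrix_inv_def by (rule someI2_ex, blast)+
  then have "dirichlet C B \<kappa> g = x \<longleftrightarrow> ?M *v x = g"
    unfolding dirichlet_def by (metis matrix_vector_mul_assoc matrix_vector_mul_lid)
  also have "\<dots> \<longleftrightarrow> (\<forall>a\<in>B. x $ a = g $ a) \<and> (\<forall>a. a \<notin> B \<longrightarrow> (laplacian C \<kappa> *v x) $ a = g $ a)"
    by (auto simp: vec_eq_iff dirichlet_matrix_mult)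
  finally show ?thesis .
qed

lemma dirichlet_boundary:
  assumes "\<kappa> \<in> conductances C" "range (inp C) \<subseteq> B" "a \<in> B"
  shows "dirichlet C B \<kappa> g $ a = g $ a"
  using dirichlet_eq_iff[OF assms(1,2)] assms(3) by blast

lemma dirichlet_interior:
  assumes "\<kappa> \<in> conductances C" "range (inp C) \<subseteq> B" "a \<notin> B"
  shows "(laplacian C \<kappa> *v dirichlet C B \<kappa> g) $ a = g $ a"
  using dirichlet_eq_iff[OF assms(1,2)] assms(3) by blast

text \<open>Without sources the interior equations are homogeneous, and a factor in front of the
  Laplacian does not change their solutions.\<close>

lemma dirichlet_scale_boundary_data:
  assumes "\<kappa> \<in> conductances C" "range (inp C) \<subseteq> B" "c > 0" "\<And>a. a \<notin> B \<Longrightarrow> g $ a = 0"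
  shows "dirichlet C B (c *\<^sub>R \<kappa>) g = dirichlet C B \<kappa> g"
  using assms by (simp add: dirichlet_eq_iff conductances_scale laplacian_scale_mult
      dirichlet_boundary dirichlet_interior)

text \<open>With grounded boundary, fixed currents through conductances \<open>c\<close> times as
  large need voltages divided by \<open>c\<close>.\<close>

lemma dirichlet_scale_source_data:
  assumes "\<kappa> \<in> conductances C" "range (inp C) \<subseteq> B" "c > 0" "\<And>a. a \<in> B \<Longrightarrow> g $ a = 0"
  shows "dirichlet C B (c *\<^sub>R \<kappa>) g = inverse c *\<^sub>R dirichlet C B \<kappa> g"
  using assms by (simp add: dirichlet_eq_iff conductances_scale laplacian_scale_mult
      dirichlet_boundary dirichlet_interior matrix_vector_mult_scaleR)

lemma dirichlet_scale_data: "dirichlet C B \<kappa> (c *\<^sub>R g) = c *\<^sub>R dirichlet C B \<kappa> g"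
  by (simp add: dirichlet_def matrix_vector_mult_scaleR)

text \<open>Dirichlet's principle: with no sources in the interior, the harmonic extension is the unique
  minimizer of the energy, because the first variation vanishes.\<close>

lemma arg_min_energy_eq_dirichlet:
  assumes "\<kappa> \<in> conductances C" "range (inp C) \<subseteq> B"
    and P: "\<And>x. P x \<longleftrightarrow> (\<forall>a\<in>B. x $ a = g $ a)"
    and g: "\<And>a. a \<notin> B \<Longrightarrow> g $ a = 0"
  shows "arg_min (energy C \<kappa>) P = dirichlet C B \<kappa> g"
proof -
  let ?x = "dirichlet C B \<kappa> g" and ?L = "laplacian C \<kappa>"
  have Px: "P ?x" using assms(1,2) P by (simp add: dirichlet_boundary)
  have less: "energy C \<kappa> ?x < energy C \<kappa> y" if "P y" "y \<noteq> ?x" for y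
  proof -
    let ?h = "y - ?x"
    have B: "?h $ a = 0" if "a \<in> B" for a using that Px \<open>P y\<close> P by simp
    \<comment> \<open>The variation vanishes on \<open>B\<close> and the current of the extension
      vanishes off \<open>B\<close>.\<close>
    have "?h $ a * (?L *v ?x) $ a = 0" for a
      using B assms by (cases "a \<in> B") (auto simp: dirichlet_interior)
    then have "?h \<bullet> (?L *v ?x) = 0" unfolding inner_vec_def inner_real_def by (intro sum.neutral) blast
    moreover have "transpose (Pmat C) *v ?h = 0"
      unfolding vec_eq_iff transpose_Pmat_mult zero_index using B assms(2) by blast
    then have "0 < ?h \<bullet> (?L *v ?h)"
      using assms(1) that(2) unfolding conductances_def by simp
    \<comment> \<open>The energy is quadratic, so this expansion is exact; symmetry merges the two
      cross terms.\<close>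
    moreover have "energy C \<kappa> (?x + ?h) =
        energy C \<kappa> ?x + ?h \<bullet> (?L *v ?x) + 1/2 * (?h \<bullet> (?L *v ?h))"
      using laplacian_symmetric[of ?x C \<kappa> ?h]
      unfolding energy_def matrix_vector_right_distrib inner_add_left inner_add_right by argo
    ultimately show ?thesis by simp
  qed
  show ?thesis
    unfolding arg_min_def is_arg_min_def
  proof (rule some_equality)
    show "P ?x \<and> (\<nexists>y. P y \<and> energy C \<kappa> y < energy C \<kappa> ?x)"
      using Px less by (metis less_asym)
    show "x = ?x" if "P x \<and> (\<nexists>y. P y \<and> energy C \<kappa> y < energy C \<kappa> x)" for x
      using that Px less by blast
  qed
qed

section \<open>The learning fields\<close>

definition input_nodes :: "('n, 'e, 'i, 'o) circuit \<Rightarrow> 'n set" where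
  "input_nodes C = range (inp C)"

definition terminals :: "('n, 'e, 'i, 'o) circuit \<Rightarrow> 'n set" where
  "terminals C = range (inp C) \<union> range (outp C)"

lemma range_inp_subset: "range (inp C) \<subseteq> input_nodes C" "range (inp C) \<subseteq> terminals C"
  by (auto simp: input_nodes_def terminals_def)

lemma wf_circuit_port_inj:
  assumes "wf_circuit C"
  shows "inj (inp C)" "inj (outp C)" "inp C i \<noteq> outp C j" "outp C j \<noteq> inp C i"
  using assms by (force simp: wf_circuit_def)+

lemma Pmat_mult_port:
  assumes "wf_circuit C"
  shows "(Pmat C *v \<mu>) $ inp C i = \<mu> $ i" "(Pmat C *v \<mu>) $ outp C j = 0"
    "a \<notin> range (inp C) \<Longrightarrow> (Pmat C *v \<mu>) $ a = 0"
  using wf_circuit_port_inj[OF assms] by (auto simp: Pmat_mult)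

lemma Qmat_mult_port:
  assumes "wf_circuit C"
  shows "(Qmat C *v \<mu>) $ outp C j = \<mu> $ j" "(Qmat C *v \<mu>) $ inp C i = 0"
    "a \<notin> range (outp C) \<Longrightarrow> (Qmat C *v \<mu>) $ a = 0"
  using wf_circuit_port_inj[OF assms] by (auto simp: Qmat_mult)

section \<open>States and responses as Dirichlet solutions\<close>

text \<open>The vector \<open>Pmat C *v v\<close> equals \<open>v\<close> on the inputs and zero
  elsewhere, so it prescribes the boundary voltages and the absence of sources at once.\<close>

lemma free_state_eq_dirichlet:
  assumes "wf_circuit C" "\<kappa> \<in> conductances C"
  shows "free_state C v \<kappa> = dirichlet C (input_nodes C) \<kappa> (Pmat C *v v)"
  unfolding free_state_def
  by (rule arg_min_energy_eq_dirichlet[OF assms(2) range_inp_subset(1)])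
    (auto simp: vec_eq_iff transpose_Pmat_mult input_nodes_def Pmat_mult_port[OF assms(1)])

lemma reference_state_eq_dirichlet:
  assumes "wf_circuit C" "\<kappa> \<in> conductances C"
  shows "reference_state C v w \<kappa> = dirichlet C (terminals C) \<kappa> (Pmat C *v v + Qmat C *v w)"
  unfolding reference_state_def
  by (rule arg_min_energy_eq_dirichlet[OF assms(2) range_inp_subset(2)])
    (auto simp: vec_eq_iff transpose_Pmat_mult transpose_Qmat_mult terminals_def
      Pmat_mult_port[OF assms(1)] Qmat_mult_port[OF assms(1)])

text \<open>The current of the reference state is supported on the terminals. Inputs and outputs are
  disjoint, so restricting it to the outputs isolates the output multiplier and determines it
  uniquely.\<close>

lemma adjoint_error_eq:
  assumes "wf_circuit C" "\<kappa> \<in> conductances C"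
  shows "adjoint_error C v w \<kappa> =
    - (transpose (Qmat C) *v (laplacian C \<kappa> *v reference_state C v w \<kappa>))"
proof -
  define f where "f = laplacian C \<kappa> *v reference_state C v w \<kappa>"
  have f0: "f $ a = 0" if "a \<notin> terminals C" for a
    using that dirichlet_interior[OF assms(2) range_inp_subset(2) that] unfolding f_def
    by (simp add: reference_state_eq_dirichlet[OF assms] Pmat_mult_port(3)[OF assms(1)]
        Qmat_mult_port(3)[OF assms(1)] terminals_def)
  have "(THE \<mu>. \<exists>l. f = - (Pmat C *v l) - Qmat C *v \<mu>) = - (transpose (Qmat C) *v f)"
  proof (rule the_equality)
    have "f $ a = (- (Pmat C *v - (transpose (Pmat C) *v f))
        - Qmat C *v - (transpose (Qmat C) *v f)) $ a" for a
    proof -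
      consider i where "a = inp C i" | j where "a = outp C j" | "a \<notin> terminals C"
        by (auto simp: terminals_def)
      then show ?thesis
        by cases (simp_all add: Pmat_mult_port[OF assms(1)] Qmat_mult_port[OF assms(1)] f0
            transpose_Pmat_mult transpose_Qmat_mult terminals_def)
    qed
    then show "\<exists>l. f = - (Pmat C *v l) - Qmat C *v - (transpose (Qmat C) *v f)"
      unfolding vec_eq_iff by blast
  next
    fix \<mu> assume "\<exists>l. f = - (Pmat C *v l) - Qmat C *v \<mu>"
    then obtain l where "f = - (Pmat C *v l) - Qmat C *v \<mu>" by blast
    then show "\<mu> = - (transpose (Qmat C) *v f)"
      by (simp add: vec_eq_iff transpose_Qmat_mult Pmat_mult_port[OF assms(1)]
          Qmat_mult_port[OF assms(1)])
  qed
  then show ?thesis unfolding adjoint_error_def f_def .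
qed

text \<open>A source vanishing on the inputs also encodes the grounding condition there. The input
  multiplier is free and only absorbs the current at the inputs.\<close>

lemma resolvent_eq_dirichlet:
  assumes "wf_circuit C" "\<kappa> \<in> conductances C" and f: "\<And>i. f $ inp C i = 0"
  shows "resolvent C \<kappa> f = dirichlet C (input_nodes C) \<kappa> f"
proof -
  let ?y = "dirichlet C (input_nodes C) \<kappa> f"
  note y = dirichlet_eq_iff[OF assms(2) range_inp_subset(1)]
  show ?thesis
    unfolding resolvent_def
  proof (rule the_equality)
    \<comment> \<open>The multiplier is the residual of the current balance, read off at the
      inputs.\<close>
    let ?\<mu> = "transpose (Pmat C) *v (f - laplacian C \<kappa> *v ?y)"
    have "(laplacian C \<kappa> *v ?y + Pmat C *v ?\<mu>) $ a = f $ a" for a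
    proof (cases "a \<in> range (inp C)")
      case True
      then show ?thesis by (auto simp: Pmat_mult_port[OF assms(1)] transpose_Pmat_mult)
    next
      case False
      then show ?thesis
        using dirichlet_interior[OF assms(2) range_inp_subset(1), of a]
        by (simp add: Pmat_mult_port(3)[OF assms(1)] input_nodes_def)
    qed
    moreover have "transpose (Pmat C) *v ?y = 0"
      using dirichlet_boundary[OF assms(2) range_inp_subset(1)] f
      by (simp add: vec_eq_iff transpose_Pmat_mult input_nodes_def)
    ultimately show "\<exists>\<mu>. laplacian C \<kappa> *v ?y + Pmat C *v \<mu> = f \<and> transpose (Pmat C) *v ?y = 0"
      unfolding vec_eq_iff by blast
  next
    fix x assume "\<exists>\<mu>. laplacian C \<kappa> *v x + Pmat C *v \<mu> = f \<and> transpose (Pmat C) *v x = 0"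
    then obtain \<mu> where *: "laplacian C \<kappa> *v x + Pmat C *v \<mu> = f"
      "transpose (Pmat C) *v x = 0" by blast
    have "(laplacian C \<kappa> *v x) $ a = f $ a" if "a \<notin> input_nodes C" for a
      using that Pmat_mult_port(3)[OF assms(1), of a \<mu>] unfolding *(1)[symmetric]
      by (simp add: input_nodes_def)
    moreover have "x $ a = f $ a" if "a \<in> input_nodes C" for a
      using that *(2) f by (auto simp: vec_eq_iff transpose_Pmat_mult input_nodes_def)
    ultimately show "x = ?y" using y by metis
  qed
qed

text \<open>The effective output conductance cancels between the resolvent and its compression: \<open>R Q D z\<close>
  is the harmonic extension with output voltages \<open>z\<close>, since the currents that this extension draws at
  the outputs are exactly \<open>D z\<close>.\<close>

lemma resolvent_Dmat:
  assumes "wf_circuit C" "\<kappa> \<in> conductances C"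
  shows "resolvent C \<kappa> (Qmat C *v (Dmat C \<kappa> *v z)) = dirichlet C (terminals C) \<kappa> (Qmat C *v z)"
proof -
  have RQ: "resolvent C \<kappa> (Qmat C *v z) = dirichlet C (input_nodes C) \<kappa> (Qmat C *v z)" for z
    by (rule resolvent_eq_dirichlet[OF assms]) (rule Qmat_mult_port(2)[OF assms(1)])
  define K where "K = matrix (\<lambda>z. transpose (Qmat C) *v resolvent C \<kappa> (Qmat C *v z))"
  \<comment> \<open>\<open>matrix\<close> represents a map only when it is linear; after rewriting
    by \<open>RQ\<close> the map is multiplication by a product of matrices.\<close>
  have K: "K *v z = transpose (Qmat C) *v resolvent C \<kappa> (Qmat C *v z)" for z
    unfolding K_def RQ dirichlet_def matrix_vector_mul_assoc by simp
  define current where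
    "current z = transpose (Qmat C) *v (laplacian C \<kappa> *v dirichlet C (terminals C) \<kappa> (Qmat C *v z))" for z
  have ext: "resolvent C \<kappa> (Qmat C *v current z) = dirichlet C (terminals C) \<kappa> (Qmat C *v z)"
    (is "_ = ?y") for z
  proof -
    have "?y $ a = (Qmat C *v current z) $ a" if "a \<in> input_nodes C" for a
      using that dirichlet_boundary[OF assms(2) range_inp_subset(2), of a]
      by (auto simp: input_nodes_def terminals_def Qmat_mult_port[OF assms(1)])
    moreover have "(laplacian C \<kappa> *v ?y) $ a = (Qmat C *v current z) $ a"
      if "a \<notin> input_nodes C" for a
    proof (cases "a \<in> range (outp C)")
      case True
      then show ?thesis
        by (auto simp: Qmat_mult_port[OF assms(1)] current_def transpose_Qmat_mult)
    next
      case False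
      with that show ?thesis
        using dirichlet_interior[OF assms(2) range_inp_subset(2), of a]
        by (simp add: Qmat_mult_port[OF assms(1)] terminals_def input_nodes_def)
    qed
    ultimately show ?thesis
      unfolding RQ using dirichlet_eq_iff[OF assms(2) range_inp_subset(1)] by blast
  qed
  have Kc: "K *v current z = z" for z
    using dirichlet_boundary[OF assms(2) range_inp_subset(2)]
    by (simp add: K ext vec_eq_iff transpose_Qmat_mult terminals_def Qmat_mult_port[OF assms(1)])
  \<comment> \<open>The square matrix \<open>K\<close> has the right inverse \<open>current\<close>,
    hence is invertible, and its inverse is \<open>current\<close>.\<close>
  then have "invertible K"
    by (metis invertible_right_inverse matrix_right_invertible_surjective surjI)
  then have "matrix_inv K ** K = mat 1"
    unfolding invertible_def matrix_inv_def by (rule someI2_ex) blast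
  then have "matrix_inv K *v z = current z"
    by (metis Kc matrix_vector_mul_assoc matrix_vector_mul_lid)
  then show ?thesis using ext unfolding Dmat_def K_def by simp
qed

text \<open>EP injects the error as a current at the outputs, whereas CL and AL impose their error
  as an output voltage. This is where the degrees of homogeneity part.\<close>

lemma field_response_EP:
  assumes "wf_circuit C" "\<kappa> \<in> conductances C"
  shows "field_response C v w EP \<kappa> =
    dirichlet C (input_nodes C) \<kappa> (Qmat C *v free_error C v w \<kappa>)"
  using resolvent_eq_dirichlet[OF assms] Qmat_mult_port(2)[OF assms(1)] by simp

lemma field_response_CL:
  assumes "wf_circuit C" "\<kappa> \<in> conductances C"
  shows "field_response C v w CL \<kappa> =
    dirichlet C (terminals C) \<kappa> (Qmat C *v free_error C v w \<kappa>)"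
  using resolvent_Dmat[OF assms] by simp

lemma field_response_AL:
  assumes "wf_circuit C" "\<kappa> \<in> conductances C"
  shows "field_response C v w AL \<kappa> =
    dirichlet C (terminals C) \<kappa> (Qmat C *v adjoint_error C v w \<kappa>)"
  using resolvent_Dmat[OF assms] by simp

section \<open>Homogeneity of the fields\<close>

lemma free_error_scale: "c > 0 \<Longrightarrow> free_error C v w (c *\<^sub>R \<kappa>) = free_error C v w \<kappa>"
  by (simp add: free_error_def free_state_scale)

text \<open>The reference voltages stay fixed, so the currents they draw scale with the
  conductances.\<close>

lemma adjoint_error_scale:
  assumes "wf_circuit C" "\<kappa> \<in> conductances C" "c > 0"
  shows "adjoint_error C v w (c *\<^sub>R \<kappa>) = c *\<^sub>R adjoint_error C v w \<kappa>"
  using assms by (simp add: adjoint_error_eq conductances_scale reference_state_scale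
      laplacian_scale_mult matrix_vector_mult_scaleR)

lemma Qmat_mult_eq_0:
  assumes "wf_circuit C"
  shows "a \<notin> terminals C \<Longrightarrow> (Qmat C *v z) $ a = 0" "a \<in> input_nodes C \<Longrightarrow> (Qmat C *v z) $ a = 0"
  by (auto simp: Qmat_mult_port[OF assms] terminals_def input_nodes_def)

text \<open>The error is a fixed source, so the response has degree -1; the state has degree
  0.\<close>

lemma learning_field_EP_scale:
  assumes "wf_circuit C" "\<kappa> \<in> conductances C" "c > 0"
  shows "learning_field C v w EP (c *\<^sub>R \<kappa>) = inverse c *\<^sub>R learning_field C v w EP \<kappa>"
proof -
  have resp: "field_response C v w EP (c *\<^sub>R \<kappa>) = inverse c *\<^sub>R field_response C v w EP \<kappa>"
    unfolding field_response_EP[OF assms(1,2)] field_response_EP[OF assms(1) conductances_scale[OF assms(3,2)]]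
      free_error_scale[OF assms(3)]
    by (rule dirichlet_scale_source_data[OF assms(2) range_inp_subset(1) assms(3)])
      (rule Qmat_mult_eq_0[OF assms(1)])
  show ?thesis
    by (subst vec_eq_iff) (simp add: learning_field_def resp free_state_scale[OF assms(3)] del: field_response.simps)
qed

text \<open>The error is fixed boundary data, so response and state both have degree 0.\<close>

lemma learning_field_CL_scale:
  assumes "wf_circuit C" "\<kappa> \<in> conductances C" "c > 0"
  shows "learning_field C v w CL (c *\<^sub>R \<kappa>) = learning_field C v w CL \<kappa>"
proof -
  have "field_response C v w CL (c *\<^sub>R \<kappa>) = field_response C v w CL \<kappa>"
    unfolding field_response_CL[OF assms(1,2)] field_response_CL[OF assms(1) conductances_scale[OF assms(3,2)]]
      free_error_scale[OF assms(3)]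
    by (rule dirichlet_scale_boundary_data[OF assms(2) range_inp_subset(2) assms(3)])
      (rule Qmat_mult_eq_0[OF assms(1)])
  then show ?thesis
    by (simp add: learning_field_def free_state_scale[OF assms(3)] del: field_response.simps)
qed

text \<open>The extension operator and the state have degree 0; the degree 1 comes from the adjoint
  error, which is a current.\<close>

lemma learning_field_AL_scale:
  assumes "wf_circuit C" "\<kappa> \<in> conductances C" "c > 0"
  shows "learning_field C v w AL (c *\<^sub>R \<kappa>) = c *\<^sub>R learning_field C v w AL \<kappa>"
proof -
  have resp: "field_response C v w AL (c *\<^sub>R \<kappa>) = c *\<^sub>R field_response C v w AL \<kappa>"
    unfolding field_response_AL[OF assms(1,2)] field_response_AL[OF assms(1) conductances_scale[OF assms(3,2)]]
      adjoint_error_scale[OF assms] matrix_vector_mult_scaleR dirichlet_scale_data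
    by (subst dirichlet_scale_boundary_data[OF assms(2) range_inp_subset(2) assms(3)])
      (auto intro: Qmat_mult_eq_0[OF assms(1)])
  show ?thesis
    by (subst vec_eq_iff) (simp add: learning_field_def resp reference_state_scale[OF assms(3)] del: field_response.simps)
qed

section \<open>Local Lipschitz continuity of the learning fields\<close>

text \<open>The ball is taken relative to \<open>D\<close> so that points on the faces of the
  domain, where some conductances vanish, are covered too.\<close>

definition lipschitz_near ::
  "'a::metric_space set \<Rightarrow> 'a \<Rightarrow> ('a \<Rightarrow> 'b::metric_space) \<Rightarrow> bool" where
  "lipschitz_near D p f \<longleftrightarrow> (\<exists>\<epsilon>>0. \<exists>L. L-lipschitz_on (D \<inter> ball p \<epsilon>) f)"

lemma lipschitz_near_I:
  assumes "\<epsilon> > 0" "L-lipschitz_on (D \<inter> ball p \<epsilon>) f"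
  shows "lipschitz_near D p f"
  using assms unfolding lipschitz_near_def by blast

lemma lipschitz_near_E2:
  assumes "lipschitz_near D p f" "lipschitz_near D p g"
  obtains \<epsilon> L M where "\<epsilon> > 0" "L-lipschitz_on (D \<inter> ball p \<epsilon>) f" "M-lipschitz_on (D \<inter> ball p \<epsilon>) g"
proof -
  obtain a L b M where *: "a > 0" "b > 0" "L-lipschitz_on (D \<inter> ball p a) f"
    "M-lipschitz_on (D \<inter> ball p b) g"
    using assms unfolding lipschitz_near_def by blast
  show thesis
    by (rule that[of "min a b" L M])
      (use * in \<open>auto elim!: lipschitz_on_subset\<close>)
qed

lemma lipschitz_near_const: "lipschitz_near D p (\<lambda>x. c)"
  by (rule lipschitz_near_I[of 1]) (auto intro: lipschitz_on_constant)

lemma lipschitz_near_add: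
  fixes f g :: "'a::metric_space \<Rightarrow> 'b::real_normed_vector"
  assumes "lipschitz_near D p f" "lipschitz_near D p g"
  shows "lipschitz_near D p (\<lambda>x. f x + g x)"
proof -
  obtain \<epsilon> L M where "\<epsilon> > 0" "L-lipschitz_on (D \<inter> ball p \<epsilon>) f"
    "M-lipschitz_on (D \<inter> ball p \<epsilon>) g"
    using lipschitz_near_E2[OF assms] .
  then show ?thesis by (blast intro: lipschitz_near_I lipschitz_on_add)
qed

lemma lipschitz_near_linear:
  fixes h :: "'b::euclidean_space \<Rightarrow> 'c::real_normed_vector"
  assumes "linear h" "lipschitz_near D p f"
  shows "lipschitz_near D p (\<lambda>x. h (f x))"
proof -
  obtain \<epsilon> L where \<epsilon>: "\<epsilon> > 0" "L-lipschitz_on (D \<inter> ball p \<epsilon>) f"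
    using assms(2) unfolding lipschitz_near_def by blast
  interpret bounded_linear h using assms(1) by (simp add: linear_conv_bounded_linear)
  obtain M where "M-lipschitz_on (f ` (D \<inter> ball p \<epsilon>)) h" by (rule lipschitz_boundE)
  from lipschitz_on_compose2[OF \<epsilon>(2) this] show ?thesis
    by (rule lipschitz_near_I[OF \<epsilon>(1)])
qed

lemma lipschitz_near_id: "lipschitz_near D p (\<lambda>x. x)"
  by (rule lipschitz_near_I[of 1]) (auto intro: lipschitz_on_id)

lemma lipschitz_near_bounded:
  fixes f :: "'a::metric_space \<Rightarrow> 'b::real_normed_vector"
  assumes "L-lipschitz_on (D \<inter> ball p \<epsilon>) f" "p \<in> D" "\<epsilon> > 0" "x \<in> D \<inter> ball p \<epsilon>"
  shows "norm (f x) \<le> norm (f p) + L * \<epsilon>"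
proof -
  have "norm (f x) \<le> norm (f p) + norm (f x - f p)"
    by (rule norm_triangle_sub)
  moreover have "norm (f x - f p) \<le> L * dist x p"
    using lipschitz_onD[OF assms(1,4), of p] assms(2,3) by (simp add: dist_norm)
  moreover have "L * dist x p \<le> L * \<epsilon>"
    using assms(4) lipschitz_on_nonneg[OF assms(1)]
    by (intro mult_left_mono) (auto simp: dist_commute)
  ultimately show ?thesis by linarith
qed

text \<open>One factor is varied at a time while the other stays bounded near
  \<open>p\<close>.\<close>

lemma lipschitz_near_bilinear:
  fixes f :: "'a::metric_space \<Rightarrow> 'b::euclidean_space" and g :: "'a \<Rightarrow> 'c::euclidean_space"
    and h :: "'b \<Rightarrow> 'c \<Rightarrow> 'd::real_normed_vector"
  assumes "bilinear h" "p \<in> D" "lipschitz_near D p f" "lipschitz_near D p g"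
  shows "lipschitz_near D p (\<lambda>x. h (f x) (g x))"
proof -
  interpret bounded_bilinear h using assms(1) by (simp add: bilinear_conv_bounded_bilinear)
  obtain K where K: "K > 0" "\<And>a b. norm (h a b) \<le> norm a * norm b * K"
    using pos_bounded by blast
  obtain \<epsilon> L M where \<epsilon>: "\<epsilon> > 0" and f: "L-lipschitz_on (D \<inter> ball p \<epsilon>) f"
    and g: "M-lipschitz_on (D \<inter> ball p \<epsilon>) g"
    using lipschitz_near_E2[OF assms(3,4)] .
  define F G where "F = norm (f p) + L * \<epsilon>" and "G = norm (g p) + M * \<epsilon>"
  have LM: "L \<ge> 0" "M \<ge> 0" using f g lipschitz_on_nonneg by blast+
  have FG: "F \<ge> 0" "G \<ge> 0" using LM \<epsilon> by (auto simp: F_def G_def)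
  have "((L * G + F * M) * K)-lipschitz_on (D \<inter> ball p \<epsilon>) (\<lambda>x. h (f x) (g x))"
  proof (rule lipschitz_onI)
    fix x y assume xy: "x \<in> D \<inter> ball p \<epsilon>" "y \<in> D \<inter> ball p \<epsilon>"
    have "h (f x) (g x) - h (f y) (g y) = h (f x - f y) (g x) + h (f y) (g x - g y)"
      by (simp add: diff_left diff_right)
    then have "dist (h (f x) (g x)) (h (f y) (g y))
        \<le> norm (f x - f y) * norm (g x) * K + norm (f y) * norm (g x - g y) * K"
      by (simp only: dist_norm norm_triangle_le[OF add_mono[OF K(2) K(2)]])
    also have "\<dots> \<le> (L * dist x y) * G * K + F * (M * dist x y) * K"
      using lipschitz_near_bounded[OF f assms(2) \<epsilon> xy(2)] lipschitz_near_bounded[OF g assms(2) \<epsilon> xy(1)]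
        lipschitz_onD[OF f xy] lipschitz_onD[OF g xy] K(1) LM FG
      by (intro add_mono mult_mono) (auto simp: dist_norm F_def G_def)
    finally show "dist (h (f x) (g x)) (h (f y) (g y)) \<le> ((L * G + F * M) * K) * dist x y"
      by (simp add: algebra_simps)
  qed (use LM FG K in auto)
  then show ?thesis by (rule lipschitz_near_I[OF \<epsilon>])
qed

lemma bilinear_matrix_vector_mult:
  "bilinear ((*v) :: real^'n::finite^'m::finite \<Rightarrow> real^'n \<Rightarrow> real^'m)"
  unfolding bilinear_def
  by (auto intro!: linearI simp: matrix_vector_mult_add_rdistrib matrix_vector_right_distrib
      matrix_vector_mult_scaleR scaleR_matrix_vector_assoc[symmetric])

text \<open>The lower bound \<open>m\<close> for \<open>M p\<close> persists as \<open>m / 2\<close> near \<open>p\<close>, and then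
  \<open>M x *v (u x - u y) = (g x - g y) - (M x - M y) *v u y\<close> gives the Lipschitz bound.\<close>

lemma lipschitz_near_linear_solution:
  fixes M :: "'a::metric_space \<Rightarrow> real^'n::finite^'n" and u g :: "'a \<Rightarrow> real^'n"
  assumes p: "p \<in> D" and M: "lipschitz_near D p M" and g: "lipschitz_near D p g"
    and inv: "invertible (M p)" and eq: "\<And>x. x \<in> D \<Longrightarrow> M x *v u x = g x"
  shows "lipschitz_near D p u"
proof -
  interpret bounded_bilinear "(*v) :: real^'n^'n \<Rightarrow> real^'n \<Rightarrow> real^'n"
    using bilinear_matrix_vector_mult by (simp add: bilinear_conv_bounded_bilinear)
  obtain K where K: "K > 0" "\<And>(a::real^'n^'n) b. norm (a *v b) \<le> norm a * norm b * K"
    using pos_bounded by blast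
  \<comment> \<open>An injective linear map in finite dimension is bounded below.\<close>
  obtain m where m: "m > 0" "\<And>z. m * norm z \<le> norm (M p *v z)"
    using linear_inj_bounded_below_pos[OF matrix_vector_mul_linear inj_matrix_vector_mult[OF inv]]
    by blast
  obtain \<epsilon>0 L G where \<epsilon>0: "\<epsilon>0 > 0" "L-lipschitz_on (D \<inter> ball p \<epsilon>0) M"
    "G-lipschitz_on (D \<inter> ball p \<epsilon>0) g"
    using lipschitz_near_E2[OF M g] .
  have L: "L \<ge> 0" and G: "G \<ge> 0" using \<epsilon>0 lipschitz_on_nonneg by blast+
  \<comment> \<open>The radius keeps the perturbation of \<open>M p\<close> below
    \<open>m / 2\<close>; the summand 1 avoids a division by zero when \<open>L = 0\<close>.\<close>
  define \<epsilon> where "\<epsilon> = min \<epsilon>0 (m / 2 / (L * K + 1))"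
  have LK: "L * K + 1 > 0" using L K by (simp add: add_nonneg_pos)
  have \<epsilon>: "\<epsilon> > 0" using \<epsilon>0 m LK by (simp add: \<epsilon>_def)
  have "(L * K + 1) * \<epsilon> \<le> (L * K + 1) * (m / 2 / (L * K + 1))"
    using LK by (intro mult_left_mono) (auto simp: \<epsilon>_def)
  also have "\<dots> = m / 2" using LK by (metis less_irrefl nonzero_mult_div_cancel_left times_divide_eq_right)
  finally have LK\<epsilon>: "L * \<epsilon> * K \<le> m / 2" using \<epsilon> by (simp add: algebra_simps)
  have lipM: "L-lipschitz_on (D \<inter> ball p \<epsilon>) M" and lipg: "G-lipschitz_on (D \<inter> ball p \<epsilon>) g"
    using \<epsilon>0(2,3) by (auto elim!: lipschitz_on_subset simp: \<epsilon>_def)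
  have low: "m / 2 * norm z \<le> norm (M x *v z)" if x: "x \<in> D \<inter> ball p \<epsilon>" for x z
  proof -
    have "norm (M p - M x) \<le> L * dist p x"
      using lipschitz_onD[OF lipM, of p x] x p \<epsilon> by (auto simp: dist_norm)
    also have "\<dots> \<le> L * \<epsilon>" using x L by (intro mult_left_mono) auto
    finally have "norm (M p - M x) * norm z * K \<le> L * \<epsilon> * norm z * K"
      using K(1) by (intro mult_right_mono) auto
    with K(2) have "norm ((M p - M x) *v z) \<le> L * \<epsilon> * norm z * K" by (rule order_trans)
    also have "\<dots> \<le> m / 2 * norm z"
      using mult_right_mono[OF LK\<epsilon>, of "norm z"] by (simp add: mult_ac)
    finally have "norm (M p *v z) \<le> norm (M x *v z) + m / 2 * norm z"
      using norm_triangle_sub[of "M p *v z" "M x *v z"] by (simp add: diff_left)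
    then show ?thesis using m(2)[of z] by (simp add: field_simps)
  qed
  \<comment> \<open>A uniform bound for \<open>u\<close> on the ball: the bound for \<open>g\<close>
    divided by the lower bound \<open>m / 2\<close>.\<close>
  define U where "U = (norm (g p) + G * \<epsilon>) / (m / 2)"
  have U: "norm (u x) \<le> U" if x: "x \<in> D \<inter> ball p \<epsilon>" for x
  proof -
    have "norm (u x) * (m / 2) \<le> norm (g p) + G * \<epsilon>"
      using low[OF x, of "u x"] lipschitz_near_bounded[OF lipg p \<epsilon> x] eq[of x] x
      by (simp add: mult.commute)
    then show ?thesis unfolding U_def using m(1) by (subst pos_le_divide_eq) auto
  qed
  have U0: "U \<ge> 0" using G \<epsilon> m by (simp add: U_def)
  have "((G + L * U * K) / (m / 2))-lipschitz_on (D \<inter> ball p \<epsilon>) u"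
  proof (rule lipschitz_onI)
    fix x y assume xy: "x \<in> D \<inter> ball p \<epsilon>" "y \<in> D \<inter> ball p \<epsilon>"
    have "M x *v (u x - u y) = (g x - g y) - (M x - M y) *v u y"
      using xy eq by (simp add: diff_left diff_right)
    then have "m / 2 * norm (u x - u y) \<le> norm (g x - g y) + norm ((M x - M y) *v u y)"
      using low[OF xy(1), of "u x - u y"] norm_triangle_ineq4 by (metis order_trans)
    also have "\<dots> \<le> norm (g x - g y) + norm (M x - M y) * norm (u y) * K"
      using K(2) by simp
    also have "\<dots> \<le> G * dist x y + L * dist x y * U * K"
      using lipschitz_onD[OF lipg xy] lipschitz_onD[OF lipM xy] U[OF xy(2)] L K U0
      by (intro add_mono mult_mono) (auto simp: dist_norm)
    also have "\<dots> = (G + L * U * K) * dist x y" by (simp add: algebra_simps)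
    finally have "dist (u x) (u y) * (m / 2) \<le> (G + L * U * K) * dist x y"
      by (simp add: dist_norm mult.commute)
    then have "dist (u x) (u y) \<le> (G + L * U * K) * dist x y / (m / 2)"
      using m(1) by (subst pos_le_divide_eq) auto
    then show "dist (u x) (u y) \<le> (G + L * U * K) / (m / 2) * dist x y"
      by (simp only: times_divide_eq_left)
  qed (use G L U0 K m in simp)
  then show ?thesis by (rule lipschitz_near_I[OF \<epsilon>])
qed

text \<open>Used to pass from the Dirichlet formulas to states and responses, which are known to
  agree with them on the domain.\<close>

lemma lipschitz_near_cong:
  assumes "lipschitz_near D p f" "\<And>x. x \<in> D \<Longrightarrow> f x = g x"
  shows "lipschitz_near D p g"
  using assms unfolding lipschitz_near_def lipschitz_on_def by (metis IntD1)

lemma lipschitz_near_dirichlet: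
  assumes p: "p \<in> conductances C" and B: "range (inp C) \<subseteq> B"
    and g: "lipschitz_near (conductances C) p g"
  shows "lipschitz_near (conductances C) p (\<lambda>\<kappa>. dirichlet C B \<kappa> (g \<kappa>))"
proof (rule lipschitz_near_linear_solution[where M = "dirichlet_matrix C B", OF p _ g])
  show "invertible (dirichlet_matrix C B p)" by (rule dirichlet_matrix_invertible[OF p B])
  \<comment> \<open>The Dirichlet matrix is affine in \<kappa>: constant identity rows plus this
    linear part.\<close>
  let ?h = "\<lambda>\<kappa>. \<chi> a. if a \<in> B then 0 else laplacian C \<kappa> $ a"
  have "linear ?h"
    by (rule linearI) (auto simp: vec_eq_iff linear_add[OF linear_laplacian] laplacian_scale)
  from lipschitz_near_add[OF lipschitz_near_const[where c="\<chi> a. if a \<in> B then axis a 1 else 0"]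
      lipschitz_near_linear[OF this lipschitz_near_id]]
  show "lipschitz_near (conductances C) p (dirichlet_matrix C B)"
    by (rule lipschitz_near_cong) (simp add: vec_eq_iff dirichlet_matrix_def)
  show "dirichlet_matrix C B \<kappa> *v dirichlet C B \<kappa> (g \<kappa>) = g \<kappa>" if "\<kappa> \<in> conductances C" for \<kappa>
    using dirichlet_boundary[OF that B] dirichlet_interior[OF that B]
    by (simp add: vec_eq_iff dirichlet_matrix_mult)
qed

lemma bilinear_laplacian_mult: "bilinear (\<lambda>\<kappa> x. laplacian C \<kappa> *v x)"
  unfolding bilinear_def
  by (auto intro!: linearI simp: linear_add[OF linear_laplacian] matrix_vector_mult_add_rdistrib
      matrix_vector_right_distrib matrix_vector_mult_scaleR laplacian_scale_mult)

text \<open>The field is bilinear in response and state, and both solve Dirichlet problems with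
  locally Lipschitz data.\<close>

lemma lipschitz_near_learning_field:
  assumes wf: "wf_circuit C" and p: "p \<in> conductances C"
  shows "lipschitz_near (conductances C) p (learning_field C v w \<rho>)"
proof -
  let ?D = "conductances C"
  note matrix = lipschitz_near_linear[OF matrix_vector_mul_linear]
  have free: "lipschitz_near ?D p (free_state C v)"
    using lipschitz_near_dirichlet[OF p range_inp_subset(1) lipschitz_near_const]
    by (rule lipschitz_near_cong) (simp add: free_state_eq_dirichlet[OF wf])
  have ref: "lipschitz_near ?D p (reference_state C v w)"
    using lipschitz_near_dirichlet[OF p range_inp_subset(2) lipschitz_near_const]
    by (rule lipschitz_near_cong) (simp add: reference_state_eq_dirichlet[OF wf])
  have err: "lipschitz_near ?D p (free_error C v w)"
    using lipschitz_near_add[OF matrix[OF free, of "transpose (Qmat C)"]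
        lipschitz_near_const[of _ _ "- w"]]
    by (simp add: free_error_def[abs_def])
  have adj: "lipschitz_near ?D p (adjoint_error C v w)"
    using matrix[OF lipschitz_near_bilinear[OF bilinear_laplacian_mult p lipschitz_near_id ref],
        of "- transpose (Qmat C)"]
    by (rule lipschitz_near_cong) (simp add: adjoint_error_eq[OF wf] bilinear_lneg[OF bilinear_matrix_vector_mult])
  have st: "lipschitz_near ?D p (field_state C v w \<rho>)"
  proof -
    have "field_state C v w \<rho> = (if \<rho> = AL then reference_state C v w else free_state C v)"
      by (cases \<rho>) auto
    then show ?thesis using free ref by simp
  qed
  have resp: "lipschitz_near ?D p (field_response C v w \<rho>)"
  proof (cases \<rho>)
    case EP
    show ?thesis
      unfolding EP using lipschitz_near_dirichlet[OF p range_inp_subset(1) matrix[OF err]]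
      by (rule lipschitz_near_cong) (simp only: field_response_EP[OF wf])
  next
    case CL
    show ?thesis
      unfolding CL using lipschitz_near_dirichlet[OF p range_inp_subset(2) matrix[OF err]]
      by (rule lipschitz_near_cong) (simp only: field_response_CL[OF wf])
  next
    case AL
    show ?thesis
      unfolding AL using lipschitz_near_dirichlet[OF p range_inp_subset(2) matrix[OF adj]]
      by (rule lipschitz_near_cong) (simp only: field_response_AL[OF wf])
  qed
  have "bilinear (\<lambda>y x. \<chi> e. (incidence C e \<bullet> y) * (incidence C e \<bullet> x))"
    unfolding bilinear_def
    by (auto intro!: linearI simp: vec_eq_iff inner_add_right algebra_simps)
  from lipschitz_near_bilinear[OF this p resp st] show ?thesis
    by (simp add: learning_field_def[abs_def])
qed

section \<open>Uniqueness of learning trajectories\<close>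

text \<open>The weighted square \<open>exp (- (2 * L) * s) * (u s \<bullet> u s)\<close> is
  nonincreasing, nonnegative and zero at \<open>a\<close>. The square is differentiable even where
  \<open>u\<close> vanishes.\<close>

lemma gronwall_zero:
  fixes u u' :: "real \<Rightarrow> 'a::real_inner"
  assumes u: "\<And>s. s \<in> {a..b} \<Longrightarrow> (u has_vector_derivative u' s) (at s within {a..b})"
    and bound: "\<And>s. s \<in> {a..b} \<Longrightarrow> norm (u' s) \<le> L * norm (u s)"
    and "u a = 0" and x: "x \<in> {a..b}"
  shows "u x = 0"
proof -
  define g where "g s = exp (- (2 * L) * s) * (u s \<bullet> u s)" for s
  have cont: "continuous_on {a..b} u"
    using u has_vector_derivative_continuous continuous_on_eq_continuous_within by blast
  have "g x \<le> g a"
  \<comment> \<open>At the endpoints only one-sided derivatives are given; continuity suffices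
    there.\<close>
  proof (rule DERIV_nonpos_imp_decreasing_open[where f = g])
    show "continuous_on {a..x} g"
      unfolding g_def using x by (intro continuous_intros continuous_on_subset[OF cont]) auto
    fix s assume s: "a < s" "s < x"
    have "(u has_vector_derivative u' s) (at s)"
      using u[of s] s x by (simp add: at_within_Icc_at)
    from bounded_bilinear.has_vector_derivative[OF bounded_bilinear_inner this this]
    have "((\<lambda>s. u s \<bullet> u s) has_real_derivative 2 * (u s \<bullet> u' s)) (at s)"
      by (simp add: has_real_derivative_iff_has_vector_derivative inner_commute)
    then have "(g has_real_derivative
        exp (- (2 * L) * s) * (2 * (u s \<bullet> u' s)) + exp (- (2 * L) * s) * (- (2 * L)) * (u s \<bullet> u s)) (at s)"
      unfolding g_def by (auto intro!: derivative_eq_intros)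
    moreover have "u s \<bullet> u' s \<le> L * (u s \<bullet> u s)"
    proof -
      have "u s \<bullet> u' s \<le> norm (u s) * norm (u' s)" by (rule norm_cauchy_schwarz)
      also have "\<dots> \<le> norm (u s) * (L * norm (u s))"
        using bound[of s] s x by (intro mult_left_mono) auto
      finally show ?thesis by (simp add: dot_square_norm power2_eq_square mult_ac)
    qed
    then have "exp (- (2 * L) * s) * (2 * (u s \<bullet> u' s) - 2 * L * (u s \<bullet> u s)) \<le> 0"
      by (intro mult_nonneg_nonpos) auto
    ultimately show "\<exists>y. (g has_real_derivative y) (at s) \<and> y \<le> 0"
      by (intro exI conjI) (assumption, simp add: algebra_simps)
  qed (use x in auto)
  then have "exp (- (2 * L) * x) * (u x \<bullet> u x) \<le> 0" by (simp add: g_def \<open>u a = 0\<close>)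
  then have "u x \<bullet> u x \<le> 0" by (simp add: mult_le_0_iff)
  then show ?thesis using inner_gt_zero_iff[of "u x"] by linarith
qed

lemma removed_mono: "removed k e s \<Longrightarrow> s \<le> t \<Longrightarrow> removed k e t"
  unfolding removed_def by force

lemma time_interval_subset: "t \<in> time_interval T \<Longrightarrow> {0..t} \<subseteq> time_interval T"
  unfolding time_interval_def by (auto intro: le_less_trans[of _ "ereal t"])

lemma time_interval_mono: "T \<le> T' \<Longrightarrow> time_interval T \<subseteq> time_interval T'"
  unfolding time_interval_def by (auto intro: less_le_trans)

text \<open>At the supremum \<tau> of the times of agreement the curves share both position and
  removed edges. The surviving conductances stay positive for a while, and Gronwall on that interval
  pushes the agreement beyond \<tau>.\<close>

lemma learning_curve_unique:
  assumes wf: "wf_circuit C"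
    and k1: "learning_curve C v w \<rho> \<kappa>0 k1 T1" and k2: "learning_curve C v w \<rho> \<kappa>0 k2 T2"
    and "T1 \<le> T2" and t1: "t \<in> time_interval T1"
  shows "k1 t = k2 t"
proof (rule ccontr)
  assume ne: "k1 t \<noteq> k2 t"
  let ?F = "learning_field C v w \<rho>"
  have t2: "t \<in> time_interval T2" using t1 time_interval_mono[OF \<open>T1 \<le> T2\<close>] by blast
  have cont: "continuous_on {0..t} k" if "learning_curve C v w \<rho> \<kappa>0 k T" "t \<in> time_interval T" for k T
    using that continuous_on_subset time_interval_subset
    unfolding learning_curve_def piecewise_C1_differentiable_on_def by metis
  define A where "A = {s \<in> {0..t}. \<forall>r\<in>{0..s}. k1 r = k2 r}"
  define \<tau> where "\<tau> = Sup A"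
  have A0: "0 \<in> A" using k1 k2 t1 by (auto simp: A_def learning_curve_def time_interval_def)
  have bdd: "bdd_above A" unfolding A_def by (rule bdd_aboveI[of _ t]) auto
  have \<tau>0: "0 \<le> \<tau>" using cSup_upper[OF A0 bdd] by (simp add: \<tau>_def)
  have \<tau>t: "\<tau> \<le> t" unfolding \<tau>_def using A0 by (intro cSup_least) (auto simp: A_def)
  have lt: "k1 r = k2 r" if r: "r \<in> {0..<\<tau>}" for r
  proof -
    obtain s where "s \<in> A" "r < s"
      using r less_cSup_iff[of A r] A0 bdd by (auto simp: \<tau>_def)
    then show ?thesis using r by (auto simp: A_def)
  qed
  \<comment> \<open>Agreement on the half-open interval passes to \<tau> by continuity; for
    \<open>\<tau> = 0\<close> that interval is empty and the initial value is used.\<close>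
  have eq\<tau>: "k1 \<tau> = k2 \<tau>"
  proof (cases "\<tau> = 0")
    case True
    then show ?thesis using k1 k2 by (simp add: learning_curve_def)
  next
    case False
    then have cl: "closure {0..<\<tau>} = {0..\<tau>}" using \<tau>0 by (simp add: closure_atLeastLessThan)
    have "continuous_on {0..\<tau>} (\<lambda>s. k1 s - k2 s)"
      using \<tau>t by (intro continuous_intros continuous_on_subset[OF cont[OF k1 t1]]
          continuous_on_subset[OF cont[OF k2 t2]]) auto
    then have "k1 \<tau> - k2 \<tau> = 0"
      using \<tau>0 lt cl continuous_constant_on_closure[of "{0..<\<tau>}" "\<lambda>s. k1 s - k2 s" 0 \<tau>] by simp
    then show ?thesis by simp
  qed
  have agree: "k1 r = k2 r" if "r \<in> {0..\<tau>}" for r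
    using lt eq\<tau> that by (cases "r = \<tau>") auto
  have "\<tau> < t" using \<tau>t ne eq\<tau> by (cases "\<tau> = t") auto
  define p where "p = k1 \<tau>"
  define Z where "Z = {e. removed k1 e \<tau>}"
  have Z1: "\<forall>e. removed k1 e \<tau> \<longleftrightarrow> e \<in> Z" by (simp add: Z_def)
  \<comment> \<open>Removal depends only on the history up to \<tau>, on which the curves
    agree.\<close>
  have Z2: "\<forall>e. removed k2 e \<tau> \<longleftrightarrow> e \<in> Z"
    unfolding Z_def removed_def using agree by auto
  have "\<tau> \<in> time_interval T1" using time_interval_subset[OF t1] \<tau>0 \<tau>t by auto
  then have p: "p \<in> conductances C" using k1 by (auto simp: p_def learning_curve_def)
  obtain \<epsilon> L where \<epsilon>: "\<epsilon> > 0" and L: "L-lipschitz_on (conductances C \<inter> ball p \<epsilon>) ?F"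
    using lipschitz_near_learning_field[OF wf p] unfolding lipschitz_near_def by blast
  \<comment> \<open>On \<open>U\<close> the Lipschitz bound is available on the domain and no
    surviving edge reaches zero.\<close>
  define U where "U = ball p \<epsilon> \<inter> (\<Inter>e\<in>-Z. {x. 0 < x $ e})"
  have "open U"
    unfolding U_def by (intro open_Int open_INT ballI open_ball open_Collect_less continuous_intros) auto
  moreover have "0 < p $ e" if "e \<notin> Z" for e
  proof -
    have "p $ e \<noteq> 0" using that \<tau>0 by (auto simp: Z_def removed_def p_def)
    then show ?thesis using p by (simp add: conductances_def order_less_le)
  qed
  then have "p \<in> U" using \<epsilon> by (simp add: U_def)
  ultimately obtain \<eta> where \<eta>: "\<eta> > 0" "ball p \<eta> \<subseteq> U"
    using open_contains_ball by blast
  have near: "\<exists>\<delta>>0. \<forall>s\<in>{0..t}. dist s \<tau> < \<delta> \<longrightarrow> k s \<in> U"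
    if "continuous_on {0..t} k" "k \<tau> = p" for k
  proof -
    have "\<exists>\<delta>>0. \<forall>s\<in>{0..t}. dist s \<tau> < \<delta> \<longrightarrow> dist (k s) (k \<tau>) < \<eta>"
      using that(1) \<eta>(1) \<tau>0 \<tau>t unfolding continuous_on_iff by auto
    then show ?thesis using \<eta>(2) that(2) by (fastforce simp: dist_commute)
  qed
  obtain \<delta>1 where \<delta>1: "\<delta>1 > 0" "\<And>s. s \<in> {0..t} \<Longrightarrow> dist s \<tau> < \<delta>1 \<Longrightarrow> k1 s \<in> U"
    using near[OF cont[OF k1 t1]] p_def by blast
  obtain \<delta>2 where \<delta>2: "\<delta>2 > 0" "\<And>s. s \<in> {0..t} \<Longrightarrow> dist s \<tau> < \<delta>2 \<Longrightarrow> k2 s \<in> U"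
    using near[OF cont[OF k2 t2]] p_def eq\<tau> by auto
  \<comment> \<open>Halving makes the distance to \<tau> strictly smaller than both radii.\<close>
  define b where "b = min t (\<tau> + min \<delta>1 \<delta>2 / 2)"
  have b: "\<tau> < b" "b \<le> t" using \<open>\<tau> < t\<close> \<delta>1(1) \<delta>2(1) by (auto simp: b_def)
  have b_near: "s \<in> {0..t}" "dist s \<tau> < \<delta>1" "dist s \<tau> < \<delta>2" if "s \<in> {\<tau>..b}" for s
    using that \<tau>0 b \<delta>1(1) \<delta>2(1) by (auto simp: b_def dist_real_def min_def split: if_splits)
  have U1: "\<forall>s\<in>{\<tau>..b}. k1 s \<in> U" using \<delta>1(2) b_near by blast
  have U2: "\<forall>s\<in>{\<tau>..b}. k2 s \<in> U" using \<delta>2(2) b_near by blast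
  text \<open>No edge is removed during \<open>[\<tau>, b]\<close>, so there both curves solve the same Lipschitz
    differential equation on the surviving edges.\<close>
  have regular: "k s \<in> conductances C \<and>
      (\<forall>e. if e \<in> Z then k s $ e = 0
           else ((\<lambda>s. k s $ e) has_real_derivative ?F (k s) $ e) (at s within {\<tau>..b}))"
    if k: "learning_curve C v w \<rho> \<kappa>0 k T" "t \<in> time_interval T" "\<forall>s\<in>{\<tau>..b}. k s \<in> U"
      "\<forall>e. removed k e \<tau> \<longleftrightarrow> e \<in> Z" and s: "s \<in> {\<tau>..b}" for k T s
  proof -
    have sub: "{\<tau>..b} \<subseteq> time_interval T"
      using time_interval_subset[OF k(2)] b \<tau>0 by auto
    have "removed k e s \<longleftrightarrow> e \<in> Z" for e
    proof
      assume "removed k e s"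
      then obtain r where r: "0 \<le> r" "r \<le> s" "k r $ e = 0" by (auto simp: removed_def)
      show "e \<in> Z"
      proof (cases "r \<le> \<tau>")
        case True
        then have "removed k e \<tau>" using r by (auto simp: removed_def)
        then show ?thesis by (simp add: k(4))
      next
        case False
        then have "k r \<in> U" using r s k(3) by simp
        then show ?thesis using r(3) by (force simp: U_def)
      qed
    next
      assume "e \<in> Z"
      then have "removed k e \<tau>" by (simp add: k(4))
      then show "removed k e s" using s by (auto elim: removed_mono)
    qed
    then show ?thesis
      using k(1) s sub has_field_derivative_subset[OF _ sub] unfolding learning_curve_def
      by (smt (verit) subsetD)
  qed
  note r1 = regular[OF k1 t1 U1 Z1] and r2 = regular[OF k2 t2 U2 Z2]
  let ?u = "\<lambda>s. k1 s - k2 s"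
  \<comment> \<open>On removed edges both curves are identically zero, whatever the field is there;
    discarding these components only decreases the norm.\<close>
  define u' where "u' s = (\<chi> e. if e \<in> Z then 0 else ?F (k1 s) $ e - ?F (k2 s) $ e)" for s
  have zero: "?u x = 0" if x: "x \<in> {\<tau>..b}" for x
  proof (rule gronwall_zero[where u = ?u and u' = u' and L = L, OF _ _ _ x])
    show "?u \<tau> = 0" using eq\<tau> by simp
    fix s assume s: "s \<in> {\<tau>..b}"
    have "((\<lambda>s. ?u s $ e) has_vector_derivative u' s $ e) (at s within {\<tau>..b})" for e
    proof (cases "e \<in> Z")
      case True
      have "?u r $ e = 0" if "r \<in> {\<tau>..b}" for r
        using r1[OF that] r2[OF that] True by auto
      then have "((\<lambda>s. ?u s $ e) has_vector_derivative 0) (at s within {\<tau>..b})"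
        by (rule has_vector_derivative_transform[OF s _ has_vector_derivative_const])
      then show ?thesis using True by (simp add: u'_def)
    next
      case False
      have "((\<lambda>s. k1 s $ e) has_vector_derivative ?F (k1 s) $ e) (at s within {\<tau>..b})"
        "((\<lambda>s. k2 s $ e) has_vector_derivative ?F (k2 s) $ e) (at s within {\<tau>..b})"
        using r1[OF s] r2[OF s] False
        by (metis has_real_derivative_iff_has_vector_derivative)+
      from has_vector_derivative_diff[OF this] show ?thesis using False by (simp add: u'_def)
    qed
    then show "(?u has_vector_derivative u' s) (at s within {\<tau>..b})"
      unfolding has_vector_derivative_def
      by (subst has_derivative_componentwise_within)
        (auto simp: Basis_vec_def cart_eq_inner_axis[symmetric])
    have "norm (u' s) \<le> norm (?F (k1 s) - ?F (k2 s))"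
      by (rule norm_le_componentwise_cart) (simp add: u'_def)
    also have "\<dots> \<le> L * norm (?u s)"
      using lipschitz_onD[OF L, of "k1 s" "k2 s"] r1[OF s] r2[OF s] U1 U2 s
      by (simp add: dist_norm U_def)
    finally show "norm (u' s) \<le> L * norm (?u s)" .
  qed
  have "k1 r = k2 r" if "r \<in> {0..b}" for r
    using that agree[of r] zero[of r] by (cases "r \<le> \<tau>") auto
  then have "b \<in> A" using b \<tau>0 by (auto simp: A_def)
  then have "b \<le> \<tau>" using cSup_upper[OF _ bdd] by (simp add: \<tau>_def)
  then show False using b by simp
qed

text \<open>The curve with the longer lifetime extends the other one, so maximality forces equal
  lifetimes.\<close>

lemma learning_trajectory_unique:
  assumes wf: "wf_circuit C"
    and 1: "learning_trajectory C v w \<rho> \<kappa>0 k1 T1" and 2: "learning_trajectory C v w \<rho> \<kappa>0 k2 T2"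
  shows "T1 = T2 \<and> (\<forall>t\<in>time_interval T1. k1 t = k2 t)"
proof -
  have *: "T2 = T1 \<and> (\<forall>t\<in>time_interval T1. k2 t = k1 t)"
    if 1: "learning_trajectory C v w \<rho> \<kappa>0 k1 T1" and 2: "learning_trajectory C v w \<rho> \<kappa>0 k2 T2"
      and "T1 \<le> T2" for k1 k2 T1 T2
    using learning_curve_unique[OF wf _ _ \<open>T1 \<le> T2\<close>, of v w \<rho> \<kappa>0 k1 k2] 1 2 \<open>T1 \<le> T2\<close>
    unfolding learning_trajectory_def by metis
  show ?thesis using *[OF 1 2] *[OF 2 1] linear[of T1 T2] by metis
qed

section \<open>Scaling of trajectories\<close>

text \<open>\<open>speed \<rho> c\<close> is \<open>c powi (p - 1)\<close> for the degree \<open>p\<close> of homogeneity of the rule. A scaled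
  trajectory only has to be run at this constant speed, since \<open>c\<close> times the velocity at \<open>\<kappa>\<close>
  is a constant multiple of the velocity at \<open>c *\<^sub>R \<kappa>\<close>.\<close>

fun speed :: "rule \<Rightarrow> real \<Rightarrow> real" where
  "speed EP c = inverse (c * c)"
| "speed CL c = inverse c"
| "speed AL c = 1"

lemma speed_pos: "c > 0 \<Longrightarrow> speed \<rho> c > 0"
  by (cases \<rho>) auto

lemma speed_inverse: "speed \<rho> (inverse c) = inverse (speed \<rho> c)"
  by (cases \<rho>) auto

text \<open>The scalar is \<open>inverse c\<close>, 1 or \<open>c\<close> for EP, CL and AL: one
  formula for the three degrees.\<close>

lemma learning_field_scale:
  assumes "wf_circuit C" "\<kappa> \<in> conductances C" "c > 0"
  shows "learning_field C v w \<rho> (c *\<^sub>R \<kappa>) = (c * speed \<rho> c) *\<^sub>R learning_field C v w \<rho> \<kappa>"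
  using assms by (cases \<rho>)
    (simp_all add: learning_field_EP_scale learning_field_CL_scale learning_field_AL_scale)

lemma time_interval_divide:
  assumes "a > 0"
  shows "t \<in> time_interval (T / ereal a) \<longleftrightarrow> a * t \<in> time_interval T"
  using assms by (auto simp: time_interval_def ereal_less_divide_pos zero_le_mult_iff)

lemma time_interval_divide_image:
  assumes "a > 0"
  shows "(\<lambda>t. a * t) ` time_interval (T / ereal a) = time_interval T"
proof -
  have "t = a * (t / a)" "t / a \<in> time_interval (T / ereal a)" if "t \<in> time_interval T" for t
    using that assms by (auto simp: time_interval_divide)
  then show ?thesis using time_interval_divide[OF assms] by blast
qed

lemma ereal_divide_inverse_cancel:
  assumes "a > 0"
  shows "T / ereal a / ereal (inverse a) = T"
  using assms by (cases T) (auto simp: field_simps)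

text \<open>By the chain rule the scaled curve has velocity \<open>c * a\<close> times the field at
  \<open>k (a * t)\<close>, which by homogeneity is the field at the scaled point.\<close>

lemma learning_curve_scale:
  assumes wf: "wf_circuit C" and c: "c > 0" and k: "learning_curve C v w \<rho> \<kappa>0 k T"
  defines "a \<equiv> speed \<rho> c"
  shows "learning_curve C v w \<rho> (c *\<^sub>R \<kappa>0) (\<lambda>t. c *\<^sub>R k (a * t)) (T / ereal a)"
proof -
  let ?I = "time_interval (T / ereal a)" and ?k = "\<lambda>t. c *\<^sub>R k (a * t)"
  have a: "a > 0" using speed_pos[OF c] by (simp add: a_def)
  have image: "(\<lambda>t. a * t) ` ?I = time_interval T" by (rule time_interval_divide_image[OF a])
  \<comment> \<open>A positive factor creates no zeros, so every removal time is merely divided by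
    \<open>a\<close>.\<close>
  have removed: "removed ?k e t \<longleftrightarrow> removed k e (a * t)" for e t
  proof -
    have "(\<exists>s. 0 \<le> s \<and> s \<le> t \<and> k (a * s) $ e = 0) \<longleftrightarrow> (\<exists>s. 0 \<le> s \<and> s \<le> a * t \<and> k s $ e = 0)"
      (is "?L \<longleftrightarrow> ?R")
    proof
      assume ?L
      then show ?R using a by (metis mult_le_cancel_left_pos zero_le_mult_iff less_imp_le)
    next
      assume ?R
      then obtain s where "0 \<le> s" "s \<le> a * t" "k s $ e = 0" by blast
      then show ?L using a by (intro exI[of _ "s / a"]) (auto simp: field_simps)
    qed
    then show ?thesis using c by (simp add: removed_def)
  qed
  have "0 < T / ereal a" using k a by (simp add: learning_curve_def ereal_less_divide_pos)
  moreover have "?k piecewise_C1_differentiable_on ?I"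
  proof -
    have "(k \<circ> (\<lambda>t. a *\<^sub>R t + 0)) piecewise_C1_differentiable_on ?I"
      by (rule piecewise_C1_differentiable_affine)
        (use k image in \<open>simp add: learning_curve_def\<close>)
    then have "(\<lambda>t. k (a * t)) piecewise_C1_differentiable_on ?I" by (simp add: o_def)
    then show ?thesis
      unfolding piecewise_C1_differentiable_on_def
      by (auto intro!: continuous_on_scaleR C1_differentiable_on_scaleR continuous_intros)
  qed
  moreover have "?k t \<in> conductances C \<and>
        (\<forall>e. if removed ?k e t then ?k t $ e = 0
             else ((\<lambda>s. ?k s $ e) has_real_derivative learning_field C v w \<rho> (?k t) $ e) (at t within ?I))"
    if "t \<in> ?I" for t
  proof -
    have at: "a * t \<in> time_interval T" using that time_interval_divide[OF a] by blast
    have D: "k (a * t) \<in> conductances C" using k at by (simp add: learning_curve_def)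
    have "((\<lambda>s. ?k s $ e) has_real_derivative learning_field C v w \<rho> (?k t) $ e) (at t within ?I)"
      if "\<not> removed k e (a * t)" for e
    proof -
      have "((\<lambda>s. k s $ e) has_real_derivative learning_field C v w \<rho> (k (a * t)) $ e)
          (at (a * t) within (\<lambda>t. a * t) ` ?I)"
        using k at that unfolding learning_curve_def image by simp
      moreover have "((\<lambda>t. a * t) has_real_derivative a) (at t within ?I)"
        by (auto intro!: derivative_eq_intros)
      ultimately have "((\<lambda>s. k (a * s) $ e) has_real_derivative
          learning_field C v w \<rho> (k (a * t)) $ e * a) (at t within ?I)"
        using DERIV_image_chain[of "\<lambda>s. k s $ e" _ "\<lambda>t. a * t" t ?I a] by (simp add: o_def)
      then show ?thesis
        unfolding learning_field_scale[OF wf D c] a_def[symmetric]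
        by (auto intro!: derivative_eq_intros simp: mult_ac)
    qed
    moreover have "k (a * t) $ e = 0" if "removed k e (a * t)" for e
      using k at that unfolding learning_curve_def by metis
    ultimately show ?thesis using conductances_scale[OF c D] by (simp add: removed)
  qed
  moreover have "?k 0 = c *\<^sub>R \<kappa>0" using k by (simp add: learning_curve_def)
  ultimately show ?thesis unfolding learning_curve_def by blast
qed

lemma learning_trajectory_scale:
  assumes wf: "wf_circuit C" and c: "c > 0" and k: "learning_trajectory C v w \<rho> \<kappa>0 k T"
  defines "a \<equiv> speed \<rho> c"
  shows "learning_trajectory C v w \<rho> (c *\<^sub>R \<kappa>0) (\<lambda>t. c *\<^sub>R k (a * t)) (T / ereal a)"
  unfolding learning_trajectory_def
proof (intro conjI allI impI; (elim conjE)?)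
  have a: "a > 0" using speed_pos[OF c] by (simp add: a_def)
  show "learning_curve C v w \<rho> (c *\<^sub>R \<kappa>0) (\<lambda>t. c *\<^sub>R k (a * t)) (T / ereal a)"
    unfolding a_def using learning_curve_scale[OF wf c] k by (simp add: learning_trajectory_def)
  fix k' T'
  assume k': "learning_curve C v w \<rho> (c *\<^sub>R \<kappa>0) k' T'" and le: "T / ereal a \<le> T'"
    and ext: "\<forall>t\<in>time_interval (T / ereal a). k' t = c *\<^sub>R k (a * t)"
  \<comment> \<open>Scaling an extension back by \<open>inverse c\<close> yields an extension of the
    original trajectory, which is maximal.\<close>
  have "learning_curve C v w \<rho> \<kappa>0 (\<lambda>t. inverse c *\<^sub>R k' (inverse a * t)) (T' / ereal (inverse a))"
    using learning_curve_scale[OF wf _ k', of "inverse c"] c by (simp add: speed_inverse a_def)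
  moreover have "T \<le> T' / ereal (inverse a)"
    using ereal_divide_right_mono[OF le, of "ereal (inverse a)"] a
    by (simp add: ereal_divide_inverse_cancel)
  moreover have "inverse c *\<^sub>R k' (inverse a * t) = k t" if "t \<in> time_interval T" for t
  proof -
    have "inverse a * t \<in> time_interval (T / ereal a)"
      using that a by (simp add: time_interval_divide mult.assoc[symmetric])
    then show ?thesis using ext a c by (simp add: mult.assoc[symmetric])
  qed
  ultimately have "T' / ereal (inverse a) = T"
    using k unfolding learning_trajectory_def by blast
  then show "T' = T / ereal a"
    using ereal_divide_inverse_cancel[of "inverse a" T'] a by simp
qed

section \<open>Limit sets and selected maps\<close>

lemma omega_limit_scale_subset:
  assumes c: "c > 0" and a: "a > 0"
    and eq: "\<And>t. t \<in> time_interval (T / ereal a) \<Longrightarrow> k' t = c *\<^sub>R k (a * t)"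
  shows "(*\<^sub>R) c ` omega_limit k T \<subseteq> omega_limit k' (T / ereal a)"
proof safe
  fix z assume "z \<in> omega_limit k T"
  then obtain s where s: "range s \<subseteq> time_interval T" "(\<lambda>n. ereal (s n)) \<longlonglongrightarrow> T"
    "(\<lambda>n. k (s n)) \<longlonglongrightarrow> z"
    unfolding omega_limit_def by blast
  have r: "range (\<lambda>n. s n / a) \<subseteq> time_interval (T / ereal a)"
    using s(1) a by (auto simp: time_interval_divide)
  \<comment> \<open>Multiplication by a finite constant is continuous also at an infinite
    lifetime.\<close>
  have "(\<lambda>n. ereal (inverse a) * ereal (s n)) \<longlonglongrightarrow> ereal (inverse a) * T"
    using s(2) by (intro tendsto_cmult_ereal) auto
  moreover have "ereal (inverse a) * T = T / ereal a"
    using a by (cases T) (auto simp: field_simps)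
  ultimately have "(\<lambda>n. ereal (s n / a)) \<longlonglongrightarrow> T / ereal a"
    by (simp add: field_simps)
  moreover have "k' (s n / a) = c *\<^sub>R k (s n)" for n
    using eq[of "s n / a"] r a by auto
  then have "(\<lambda>n. k' (s n / a)) \<longlonglongrightarrow> c *\<^sub>R z"
    using s(3) by (simp add: tendsto_scaleR)
  ultimately show "c *\<^sub>R z \<in> omega_limit k' (T / ereal a)"
    unfolding omega_limit_def using r by blast
qed

text \<open>The reverse inclusion is the first one applied to the inverse scaling and the inverse
  time change.\<close>

lemma omega_limit_scale:
  assumes c: "c > 0" and a: "a > 0"
    and eq: "\<And>t. t \<in> time_interval (T / ereal a) \<Longrightarrow> k' t = c *\<^sub>R k (a * t)"
  shows "omega_limit k' (T / ereal a) = (*\<^sub>R) c ` omega_limit k T"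
proof
  have "k t = inverse c *\<^sub>R k' (inverse a * t)" if "t \<in> time_interval T" for t
    using that eq[of "inverse a * t"] a c
    by (simp add: time_interval_divide mult.assoc[symmetric])
  then have "(*\<^sub>R) (inverse c) ` omega_limit k' (T / ereal a) \<subseteq> omega_limit k T"
    using omega_limit_scale_subset[of "inverse c" "inverse a" "T / ereal a" k k'] a c
    by (simp add: ereal_divide_inverse_cancel)
  then have "inverse c *\<^sub>R z \<in> omega_limit k T" if "z \<in> omega_limit k' (T / ereal a)" for z
    using that by blast
  then show "omega_limit k' (T / ereal a) \<subseteq> (*\<^sub>R) c ` omega_limit k T"
    using c by (force intro: image_eqI[of _ _ "inverse c *\<^sub>R _"])
qed (rule omega_limit_scale_subset[where k = k, OF c a eq])

text \<open>The domain is a cone and the input-output map is constant along its rays.\<close>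

lemma selected_maps_scale:
  assumes c: "c > 0" and \<omega>: "omega_limit k' T' = (*\<^sub>R) c ` omega_limit k T"
  shows "selected_maps C k' T' = selected_maps C k T"
proof -
  have "c *\<^sub>R z \<in> conductances C \<longleftrightarrow> z \<in> conductances C" for z
    using conductances_scale[of c z C] conductances_scale[of "inverse c" "c *\<^sub>R z" C] c by auto
  then have "omega_limit k' T' \<inter> conductances C = (*\<^sub>R) c ` (omega_limit k T \<inter> conductances C)"
    unfolding \<omega> by blast
  moreover have "selected_maps C k T = io_map C ` (omega_limit k T \<inter> conductances C)" for k T
    by (auto simp: selected_maps_def)
  ultimately show ?thesis by (simp add: image_image io_map_scale[OF c])
qed

text \<open>Uniqueness identifies an arbitrary trajectory from the scaled initialization with the
  explicitly scaled one, from which everything is read off.\<close>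

lemma learning_trajectory_rescaled:
  assumes wf: "wf_circuit C" and c: "c > 0" and k: "learning_trajectory C v w \<rho> \<kappa>0 k T"
    and k': "learning_trajectory C v w \<rho> (c *\<^sub>R \<kappa>0) k' T'"
  shows "\<exists>\<phi>. time_change T' T \<phi> \<and> (\<forall>t\<in>time_interval T'. k' t = c *\<^sub>R k (\<phi> t))"
    and "learning_orbit k' T' = (*\<^sub>R) c ` learning_orbit k T"
    and "omega_limit k' T' = (*\<^sub>R) c ` omega_limit k T"
    and "selected_maps C k' T' = selected_maps C k T"
proof -
  define a where "a = speed \<rho> c"
  have a: "a > 0" using speed_pos[OF c] by (simp add: a_def)
  have T': "T' = T / ereal a" and eq: "\<And>t. t \<in> time_interval T' \<Longrightarrow> k' t = c *\<^sub>R k (a * t)"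
    using learning_trajectory_unique[OF wf k' learning_trajectory_scale[OF wf c k]]
    unfolding a_def by blast+
  have image: "(\<lambda>t. a * t) ` time_interval T' = time_interval T"
    unfolding T' by (rule time_interval_divide_image[OF a])
  have "time_change T' T (\<lambda>t. a * t)"
    unfolding time_change_def bij_betw_def
    using a image by (auto simp: inj_on_def strict_mono_on_def)
  then show "\<exists>\<phi>. time_change T' T \<phi> \<and> (\<forall>t\<in>time_interval T'. k' t = c *\<^sub>R k (\<phi> t))"
    using eq by blast
  show "learning_orbit k' T' = (*\<^sub>R) c ` learning_orbit k T"
    unfolding learning_orbit_def image[symmetric] image_image using eq by (rule image_cong[OF refl])
  show \<omega>: "omega_limit k' T' = (*\<^sub>R) c ` omega_limit k T"
    using eq unfolding T' by (rule omega_limit_scale[OF c a])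
  show "selected_maps C k' T' = selected_maps C k T"
    by (rule selected_maps_scale[OF c \<omega>])
qed

section \<open>Direction and mass of the initialization\<close>

lemma norm_pos_of_components_pos:
  fixes x :: "real^'n::finite"
  assumes "\<forall>i. 0 < x $ i"
  shows "0 < norm x"
  using assms by (metis less_irrefl zero_index zero_less_norm_iff)

lemma mass_eq_norm: "mass x = (norm x)\<^sup>2 / 2"
  by (simp add: mass_def norm_vec_def L2_set_def sum_nonneg)

text \<open>The last two conjuncts separate direction from mass: equal directions give equal
  selected maps, and every positive mass is attained on the ray of a given initialization with the
  same selected maps.\<close>

theorem proposition2:
  fixes C :: "('n::finite, 'e::finite, 'i::finite, 'o::finite) circuit"
    and v :: "real^'i" and w :: "real^'o"
  assumes "wf_circuit C"
  shows
    "(\<forall>c>0. \<forall>\<kappa>\<in>conductances C.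
        c *\<^sub>R \<kappa> \<in> conductances C \<and>
        learning_field C v w EP (c *\<^sub>R \<kappa>) = inverse c *\<^sub>R learning_field C v w EP \<kappa> \<and>
        learning_field C v w CL (c *\<^sub>R \<kappa>) = learning_field C v w CL \<kappa> \<and>
        learning_field C v w AL (c *\<^sub>R \<kappa>) = c *\<^sub>R learning_field C v w AL \<kappa> \<and>
        io_map C (c *\<^sub>R \<kappa>) = io_map C \<kappa>)
   \<and> (\<forall>\<rho>. \<forall>c>0. \<forall>\<kappa>0. (\<forall>e. 0 < \<kappa>0 $ e) \<longrightarrow>
        (\<forall>k T. learning_trajectory C v w \<rho> \<kappa>0 k T \<longrightarrow>
           (\<exists>k' T'. learning_trajectory C v w \<rho> (c *\<^sub>R \<kappa>0) k' T') \<and>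
           (\<forall>k' T'. learning_trajectory C v w \<rho> (c *\<^sub>R \<kappa>0) k' T' \<longrightarrow>
              (\<exists>\<phi>. time_change T' T \<phi> \<and> (\<forall>t\<in>time_interval T'. k' t = c *\<^sub>R k (\<phi> t))) \<and>
              learning_orbit k' T' = (*\<^sub>R) c ` learning_orbit k T \<and>
              omega_limit k' T' = (*\<^sub>R) c ` omega_limit k T \<and>
              selected_maps C k' T' = selected_maps C k T)))
   \<and> (\<forall>\<rho> \<kappa>0 \<kappa>1 k0 T0 k1 T1.
        (\<forall>e. 0 < \<kappa>0 $ e) \<and> (\<forall>e. 0 < \<kappa>1 $ e) \<and>
        \<kappa>0 /\<^sub>R norm \<kappa>0 = \<kappa>1 /\<^sub>R norm \<kappa>1 \<and>
        learning_trajectory C v w \<rho> \<kappa>0 k0 T0 \<and> learning_trajectory C v w \<rho> \<kappa>1 k1 T1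
        \<longrightarrow> selected_maps C k0 T0 = selected_maps C k1 T1)
   \<and> (\<forall>\<rho> \<kappa>0 k0 T0. \<forall>M>0. (\<forall>e. 0 < \<kappa>0 $ e) \<and> learning_trajectory C v w \<rho> \<kappa>0 k0 T0 \<longrightarrow>
        (\<exists>\<kappa>1 k1 T1. (\<forall>e. 0 < \<kappa>1 $ e) \<and> \<kappa>1 /\<^sub>R norm \<kappa>1 = \<kappa>0 /\<^sub>R norm \<kappa>0 \<and> mass \<kappa>1 = M \<and>
           learning_trajectory C v w \<rho> \<kappa>1 k1 T1 \<and> selected_maps C k1 T1 = selected_maps C k0 T0))"
proof (intro conjI allI ballI impI; (elim conjE)?)
  fix c :: real and \<kappa> :: "real^'e"
  assume c: "0 < c" and \<kappa>: "\<kappa> \<in> conductances C"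
  note * = assms \<kappa> c
  show "c *\<^sub>R \<kappa> \<in> conductances C" by (rule conductances_scale[OF c \<kappa>])
  show "learning_field C v w EP (c *\<^sub>R \<kappa>) = inverse c *\<^sub>R learning_field C v w EP \<kappa>"
    by (rule learning_field_EP_scale[OF *])
  show "learning_field C v w CL (c *\<^sub>R \<kappa>) = learning_field C v w CL \<kappa>"
    by (rule learning_field_CL_scale[OF *])
  show "learning_field C v w AL (c *\<^sub>R \<kappa>) = c *\<^sub>R learning_field C v w AL \<kappa>"
    by (rule learning_field_AL_scale[OF *])
  show "io_map C (c *\<^sub>R \<kappa>) = io_map C \<kappa>" by (rule io_map_scale[OF c])
next
  fix \<rho> and c :: real and \<kappa>0 :: "real^'e" and k T
  assume c: "0 < c" and k: "learning_trajectory C v w \<rho> \<kappa>0 k T"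
  show "\<exists>k' T'. learning_trajectory C v w \<rho> (c *\<^sub>R \<kappa>0) k' T'"
    using learning_trajectory_scale[OF assms c k] by blast
  fix k' T' assume k': "learning_trajectory C v w \<rho> (c *\<^sub>R \<kappa>0) k' T'"
  note * = learning_trajectory_rescaled[OF assms c k k']
  show "\<exists>\<phi>. time_change T' T \<phi> \<and> (\<forall>t\<in>time_interval T'. k' t = c *\<^sub>R k (\<phi> t))" by (rule *)
  show "learning_orbit k' T' = (*\<^sub>R) c ` learning_orbit k T" by (rule *)
  show "omega_limit k' T' = (*\<^sub>R) c ` omega_limit k T" by (rule *)
  show "selected_maps C k' T' = selected_maps C k T" by (rule *)
next
  fix \<rho> and \<kappa>0 \<kappa>1 :: "real^'e" and k0 T0 k1 T1
  assume pos: "\<forall>e. 0 < \<kappa>0 $ e" "\<forall>e. 0 < \<kappa>1 $ e" and dir: "\<kappa>0 /\<^sub>R norm \<kappa>0 = \<kappa>1 /\<^sub>R norm \<kappa>1"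
    and k0: "learning_trajectory C v w \<rho> \<kappa>0 k0 T0" and k1: "learning_trajectory C v w \<rho> \<kappa>1 k1 T1"
  have n: "0 < norm \<kappa>0" "0 < norm \<kappa>1" using pos by (auto intro: norm_pos_of_components_pos)
  \<comment> \<open>Equal directions make one initialization a positive multiple of the other, the
    factor being the ratio of norms.\<close>
  have "\<kappa>1 = norm \<kappa>1 *\<^sub>R (\<kappa>1 /\<^sub>R norm \<kappa>1)" using n by simp
  then have "\<kappa>1 = (norm \<kappa>1 / norm \<kappa>0) *\<^sub>R \<kappa>0"
    unfolding dir[symmetric] by (simp add: divide_inverse)
  moreover have "0 < norm \<kappa>1 / norm \<kappa>0" using n by simp
  ultimately show "selected_maps C k0 T0 = selected_maps C k1 T1"
    using learning_trajectory_rescaled(4)[OF assms _ k0] k1 by metis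
next
  fix \<rho> and \<kappa>0 :: "real^'e" and k0 T0 and M :: real
  assume M: "0 < M" and pos: "\<forall>e. 0 < \<kappa>0 $ e" and k0: "learning_trajectory C v w \<rho> \<kappa>0 k0 T0"
  have n: "0 < norm \<kappa>0" by (rule norm_pos_of_components_pos[OF pos])
  \<comment> \<open>The mass is half the squared norm, so mass \<open>M\<close> means norm
    \<open>sqrt (2 * M)\<close>.\<close>
  define c where "c = sqrt (2 * M) / norm \<kappa>0"
  have c: "0 < c" using M n by (simp add: c_def)
  note k1 = learning_trajectory_scale[OF assms c k0]
  have "mass (c *\<^sub>R \<kappa>0) = M"
    using M n by (simp add: mass_eq_norm c_def power_divide power_mult_distrib)
  moreover have "c *\<^sub>R \<kappa>0 /\<^sub>R norm (c *\<^sub>R \<kappa>0) = \<kappa>0 /\<^sub>R norm \<kappa>0"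
    using c by (simp add: field_simps)
  moreover have "\<forall>e. 0 < (c *\<^sub>R \<kappa>0) $ e" using c pos by simp
  ultimately show "\<exists>\<kappa>1 k1 T1. (\<forall>e. 0 < \<kappa>1 $ e) \<and> \<kappa>1 /\<^sub>R norm \<kappa>1 = \<kappa>0 /\<^sub>R norm \<kappa>0 \<and> mass \<kappa>1 = M \<and>
      learning_trajectory C v w \<rho> \<kappa>1 k1 T1 \<and> selected_maps C k1 T1 = selected_maps C k0 T0"
    using k1 learning_trajectory_rescaled(4)[OF assms c k0 k1] by blast
qed

end
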